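(* Let $f\in\mathbb{C}[x_0,\dots,x_n]$ be a homogeneous polynomial of degree $k\ge1$, let $m$ be a monomial of degree $k-1$ in the variables $x_0,\dots,x_n$, and define $\tilde f:=f+m\cdot x_{n+1}\in\mathbb{C}[x_0,\dots,x_{n+1}]$. Then $$\deg T_{\tilde f}=\deg T_f.$$
   Context: For a homogeneous polynomial $g\in\mathbb{C}[x_0,\dots,x_N]$, the toric polar map is the rational map $T_g\colon\mathbb{P}^N\dashrightarrow\mathbb{P}^N$ (over $\mathbb{C}$), $x\mapsto(x_0g_{x_0}(x):\cdots:x_Ng_{x_N}(x))$, where $g_{x_i}=\partial g/\partial x_i$. The degree of a rational map $\mathbb{P}^N\dashrightarrow\mathbb{P}^N$ is the degree of the corresponding function field extension when it is dominant (the number of points of a general fiber) and $0$ otherwise. Thus $T_f$ is a map on $\mathbb{P}^n$ and $T_{\tilde f}$ a map on $\mathbb{P}^{n+1}$. *)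

theory Defs
  imports
    "HOL-Library.Poly_Mapping"
    "HOL-Computational_Algebra.Fraction_Field"
    "HOL-Algebra.Embedded_Algebras"
    "HOL-Algebra.Algebraic_Closure_Type"
begin

text \<open>
  Complex polynomials in variables \<open>x\<^sub>0, x\<^sub>1, \<dots>\<close>, as finitely supported coefficient functions
  on monomials; a monomial is its finitely supported exponent function. The ring of polynomials in
  \<open>x\<^sub>0, \<dots>, x\<^sub>N\<close> is the subset cut out by a condition on the variables that occur, so that rings
  for different \<open>N\<close> live in one type.
\<close>

type_synonym cmonom = "nat \<Rightarrow>\<^sub>0 nat"
type_synonym cpoly = "cmonom \<Rightarrow>\<^sub>0 complex"

definition coord_poly :: "nat \<Rightarrow> cpoly" where
  "coord_poly i = Poly_Mapping.single (Poly_Mapping.single i 1) 1"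

definition const_poly :: "complex \<Rightarrow> cpoly" where
  "const_poly c = Poly_Mapping.single 0 c"

definition monom_poly :: "cmonom \<Rightarrow> cpoly" where
  "monom_poly m = Poly_Mapping.single m 1"

definition monom_deg :: "cmonom \<Rightarrow> nat" where
  "monom_deg m = (\<Sum>i\<in>Poly_Mapping.keys m. Poly_Mapping.lookup m i)"

definition poly_vars :: "cpoly \<Rightarrow> nat set" where
  "poly_vars p = (\<Union>m\<in>Poly_Mapping.keys p. Poly_Mapping.keys m)"

text \<open>Homogeneous polynomials of degree \<open>d\<close> in \<open>x\<^sub>0, \<dots>, x\<^sub>N\<close>; as usual this includes \<open>0\<close>.\<close>

definition forms :: "nat \<Rightarrow> nat \<Rightarrow> cpoly set" where
  "forms N d =
    {p. poly_vars p \<subseteq> {..N} \<and> (\<forall>m\<in>Poly_Mapping.keys p. monom_deg m = d)}"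

definition partial_deriv :: "nat \<Rightarrow> cpoly \<Rightarrow> cpoly" where
  "partial_deriv i p =
    (\<Sum>m\<in>Poly_Mapping.keys p.
       Poly_Mapping.single (m - Poly_Mapping.single i 1)
         (of_nat (Poly_Mapping.lookup m i) * Poly_Mapping.lookup p m))"

text \<open>
  Substitution of ring elements \<open>x i\<close> for the variables, with coefficients mapped by \<open>c\<close>.
\<close>

definition subst_poly :: "(complex \<Rightarrow> 'a::comm_ring_1) \<Rightarrow> (nat \<Rightarrow> 'a) \<Rightarrow> cpoly \<Rightarrow> 'a" where
  "subst_poly c x p =
    (\<Sum>m\<in>Poly_Mapping.keys p. c (Poly_Mapping.lookup p m) *
       (\<Prod>i\<in>Poly_Mapping.keys m. x i ^ Poly_Mapping.lookup m i))"

definition eval_poly :: "cpoly \<Rightarrow> (nat \<Rightarrow> complex) \<Rightarrow> complex" where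
  "eval_poly p x = subst_poly (\<lambda>c. c) x p"

definition compose_poly :: "cpoly \<Rightarrow> (nat \<Rightarrow> cpoly) \<Rightarrow> cpoly" where
  "compose_poly p F = subst_poly const_poly F p"

text \<open>
  Points of \<open>\<P>\<^sup>N\<close> are handled through their homogeneous coordinate vectors, padded by zeros.
  All sets of coordinate vectors that are compared below are stable under nonzero scaling, or are
  only tested against such sets.
\<close>

definition proj_points :: "nat \<Rightarrow> (nat \<Rightarrow> complex) set" where
  "proj_points N = {x. (\<exists>i\<le>N. x i \<noteq> 0) \<and> (\<forall>i>N. x i = 0)}"

definition proj_zeros :: "nat \<Rightarrow> cpoly set \<Rightarrow> (nat \<Rightarrow> complex) set" where
  "proj_zeros N S = {x \<in> proj_points N. \<forall>P\<in>S. eval_poly P x = 0}"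

text \<open>
  A rational map from \<open>\<P>\<^sup>N\<close> to itself is represented by \<open>F 0, \<dots>, F N\<close>, forms of one common degree in
  \<open>x\<^sub>0, \<dots>, x\<^sub>N\<close>. Its image is taken over the points where some \<open>F i\<close> is nonzero. This open set may
  be smaller than the domain of definition, but it has the same image closure. If all \<open>F i\<close> are
  zero, the image is empty, so \<open>F\<close> is not dominant and has degree \<open>0\<close>.
\<close>

definition rat_map_image :: "nat \<Rightarrow> (nat \<Rightarrow> cpoly) \<Rightarrow> (nat \<Rightarrow> complex) set" where
  "rat_map_image N F =
    (\<lambda>x i. if i \<le> N then eval_poly (F i) x else 0) ` proj_points N \<inter> proj_points N"

text \<open>Dominance: the image is Zariski dense, i.e. the only closed set containing it is \<open>\<P>\<^sup>N\<close>.\<close>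

definition dominant :: "nat \<Rightarrow> (nat \<Rightarrow> cpoly) \<Rightarrow> bool" where
  "dominant N F \<longleftrightarrow>
    (\<forall>S. S \<subseteq> (\<Union>d. forms N d) \<and> rat_map_image N F \<subseteq> proj_zeros N S
       \<longrightarrow> proj_zeros N S = proj_points N)"

text \<open>
  The function field of \<open>\<P>\<^sup>N\<close> (quotients of forms of equal degree), inside the fraction field of
  the polynomial ring, and the subfield of pullbacks \<open>(a/b) \<circ> F\<close>. For dominant \<open>F\<close> the condition that
  \<open>b \<circ> F\<close> be nonzero just says that \<open>b\<close> is nonzero.
\<close>

definition function_field :: "nat \<Rightarrow> cpoly fract set" where
  "function_field N =
    {Fract a b | a b d. a \<in> forms N d \<and> b \<in> forms N d \<and> b \<noteq> 0}"

definition pullback_field :: "nat \<Rightarrow> (nat \<Rightarrow> cpoly) \<Rightarrow> cpoly fract set" where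
  "pullback_field N F =
    {Fract (compose_poly a F) (compose_poly b F) | a b d.
       a \<in> forms N d \<and> b \<in> forms N d \<and> compose_poly b F \<noteq> 0}"

text \<open>
  In \<^term>\<open>ring.dim R K E\<close> the field of scalars is \<open>K\<close>. For dominant \<open>F\<close> the extension is finite, both fields having transcendence degree \<open>N\<close> over the complex numbers.
\<close>

definition rat_map_degree :: "nat \<Rightarrow> (nat \<Rightarrow> cpoly) \<Rightarrow> nat" where
  "rat_map_degree N F =
    (if dominant N F
     then ring.dim (ring_of_type_algebra :: cpoly fract ring)
            (pullback_field N F) (function_field N)
     else 0)"

definition toric_polar_map :: "cpoly \<Rightarrow> nat \<Rightarrow> cpoly" where
  "toric_polar_map g i = coord_poly i * partial_deriv i g"

end

theory Submission
  imports Defs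
begin

text \<open>
  Write \<open>F\<^sub>i = x\<^sub>i f\<^sub>i\<close> and \<open>M = m x\<^sub>n\<^sub>+\<^sub>1\<close>. The toric polar map of \<open>f + M\<close> is
  \<open>(F\<^sub>0 + \<mu>\<^sub>0 M : \<dots> : F\<^sub>n + \<mu>\<^sub>n M : M)\<close> with \<open>\<mu>\<close> the exponent of \<open>m\<close>, that is,
  \<open>(F\<^sub>0 : \<dots> : F\<^sub>n : M)\<close> up to a linear automorphism of the target. Let \<open>K\<close> be the field generated
  by the quotients \<open>F\<^sub>i / F\<^sub>0\<close> (\<open>F\<^sub>0 \<noteq> 0\<close> in the dominant case) inside the function field \<open>L\<close> of
  \<open>\<P>\<^sup>n\<close>. The element \<open>t = M / F\<^sub>0\<close> is transcendental over \<open>L\<close>, and passing from \<open>f\<close> to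
  \<open>f + M\<close> replaces the extension \<open>K \<subseteq> L\<close> by \<open>K(t) \<subseteq> L(t)\<close>, which has the same degree. Dominance
  means that no nonzero form vanishes on the components of the map, and it transfers because a
  relation between the \<open>F\<^sub>i\<close> and \<open>M\<close> can be split by powers of \<open>x\<^sub>n\<^sub>+\<^sub>1\<close>.
\<close>

section \<open>Dimension under a transcendental extension\<close>

text \<open>Rings and fields are plain subsets of one type, so that the four fields compared later
  need no embeddings. The notion applies to any commutative ring because it is also used for sets of
  polynomials.\<close>

definition subring_set :: "'a::comm_ring_1 set \<Rightarrow> bool" where
  "subring_set A \<longleftrightarrow> 1 \<in> A \<and> (\<forall>x\<in>A. \<forall>y\<in>A. x - y \<in> A \<and> x * y \<in> A)"

definition subfield_set :: "'a::field set \<Rightarrow> bool" where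
  "subfield_set K \<longleftrightarrow> subring_set K \<and> (\<forall>x\<in>K. inverse x \<in> K)"

lemma subring_setD:
  assumes "subring_set A"
  shows "1 \<in> A" "0 \<in> A" "x \<in> A \<Longrightarrow> - x \<in> A"
    "x \<in> A \<Longrightarrow> y \<in> A \<Longrightarrow> x + y \<in> A"
    "x \<in> A \<Longrightarrow> y \<in> A \<Longrightarrow> x - y \<in> A"
    "x \<in> A \<Longrightarrow> y \<in> A \<Longrightarrow> x * y \<in> A"
proof -
  show *: "1 \<in> A" "\<And>x y. x \<in> A \<Longrightarrow> y \<in> A \<Longrightarrow> x - y \<in> A"
    "x \<in> A \<Longrightarrow> y \<in> A \<Longrightarrow> x * y \<in> A"
    using assms by (auto simp: subring_set_def)
  show 0: "0 \<in> A" using *(2)[OF *(1) *(1)] by simp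
  show m: "- x \<in> A" if "x \<in> A" for x using *(2)[OF 0 that] by simp
  show "x + y \<in> A" if "x \<in> A" "y \<in> A" using *(2)[OF that(1) m[OF that(2)]] by simp
qed

lemma subring_set_sum:
  assumes "subring_set A" "\<And>i. i \<in> I \<Longrightarrow> g i \<in> A"
  shows "sum g I \<in> A"
  using assms(2) by (induction I rule: infinite_finite_induct) (auto intro: subring_setD[OF assms(1)])

lemma subring_set_prod:
  assumes "subring_set A" "\<And>i. i \<in> I \<Longrightarrow> g i \<in> A"
  shows "prod g I \<in> A"
  using assms(2) by (induction I rule: infinite_finite_induct) (auto intro: subring_setD[OF assms(1)])

lemma subring_set_power:
  assumes "subring_set A" "x \<in> A"
  shows "x ^ k \<in> A"
  using assms(2) by (induction k) (auto intro: subring_setD[OF assms(1)])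

lemma subfield_setD:
  assumes "subfield_set K"
  shows "subring_set K" "x \<in> K \<Longrightarrow> inverse x \<in> K" "x \<in> K \<Longrightarrow> y \<in> K \<Longrightarrow> x / y \<in> K"
  using assms subring_setD(6) by (auto simp: subfield_set_def divide_inverse)

text \<open>Families indexed below \<open>n\<close> replace the lists of the algebra library:
  coefficients become functions, and adjoining a vector is the update
  \<open>b(n := v)\<close>.\<close>

definition lin_indep :: "'a::field set \<Rightarrow> nat \<Rightarrow> (nat \<Rightarrow> 'a) \<Rightarrow> bool" where
  "lin_indep K n b \<longleftrightarrow>
    (\<forall>c. (\<forall>i<n. c i \<in> K) \<and> (\<Sum>i<n. c i * b i) = 0 \<longrightarrow> (\<forall>i<n. c i = 0))"

definition lin_span :: "'a::field set \<Rightarrow> nat \<Rightarrow> (nat \<Rightarrow> 'a) \<Rightarrow> 'a set" where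
  "lin_span K n b = {\<Sum>i<n. c i * b i | c. \<forall>i<n. c i \<in> K}"

section \<open>Translation of dimension from lists of vectors to indexed families\<close>

context
begin

interpretation field "ring_of_type_algebra :: 'a::field ring"
  by (rule field_from_type_algebra)

private lemma ring_simps [simp]:
  "carrier (ring_of_type_algebra :: 'a::field ring) = UNIV"
  "x \<otimes>\<^bsub>ring_of_type_algebra :: 'a ring\<^esub> y = x * y"
  "x \<oplus>\<^bsub>ring_of_type_algebra :: 'a ring\<^esub> y = x + y"
  "\<one>\<^bsub>ring_of_type_algebra :: 'a ring\<^esub> = 1"
  "\<zero>\<^bsub>ring_of_type_algebra :: 'a ring\<^esub> = 0"
  by (simp_all add: ring_of_type_algebra_def)

private lemma uminus_simp [simp]: "\<ominus>\<^bsub>ring_of_type_algebra\<^esub> x = - (x::'a::field)"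
  using r_neg[of x] by (simp add: eq_neg_iff_add_eq_0 add.commute)

private lemma inv_simp: "x \<noteq> 0 \<Longrightarrow> inv\<^bsub>ring_of_type_algebra\<^esub> x = inverse (x::'a::field)"
  by (rule comm_inv_char) auto

lemma subfield_ring_of_type_algebra:
  fixes K :: "'a::field set"
  assumes "subfield_set K"
  shows "subfield K ring_of_type_algebra"
proof (rule subfieldI')
  note D = subfield_setD[OF assms]
  show "subring K ring_of_type_algebra"
    by (rule subringI) (auto intro: subring_setD[OF D(1)])
  show "inv\<^bsub>ring_of_type_algebra\<^esub> k \<in> K" if "k \<in> K - {\<zero>\<^bsub>ring_of_type_algebra\<^esub>}" for k
    using that D(2) by (auto simp: inv_simp)
qed

private lemma combine_eq:
  "length Ks = length (Us :: 'a::field list) \<Longrightarrow> combine Ks Us = (\<Sum>i<length Us. Ks ! i * Us ! i)"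
  by (induction Ks Us rule: list_induct2) (simp_all add: sum.lessThan_Suc_shift del: sum.lessThan_Suc)

private lemma independent_iff:
  fixes K :: "'a::field set"
  assumes "subfield_set K"
  shows "independent K Us \<longleftrightarrow> lin_indep K (length Us) ((!) Us)"
proof
  note sf = subfield_ring_of_type_algebra[OF assms]
  assume ind: "independent K Us"
  show "lin_indep K (length Us) ((!) Us)"
    unfolding lin_indep_def
  proof (intro allI impI, elim conjE)
    fix c i assume c: "\<forall>i<length Us. c i \<in> K" "(\<Sum>i<length Us. c i * Us ! i) = 0"
      and i: "i < length Us"
    define Ks where "Ks = map c [0..<length Us]"
    have "combine Ks Us = \<zero>\<^bsub>ring_of_type_algebra\<^esub>"
      by (subst combine_eq) (use c in \<open>simp_all add: Ks_def\<close>)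
    moreover have "set Ks \<subseteq> K" using c by (auto simp: Ks_def)
    ultimately have "set (take (length Us) Ks) \<subseteq> {0}"
      using independent_imp_trivial_combine[OF sf ind] by simp
    hence "set Ks \<subseteq> {0}" by (simp add: Ks_def)
    moreover have "c i \<in> set Ks" using i by (auto simp: Ks_def)
    ultimately show "c i = 0" by auto
  qed
next
  note sf = subfield_ring_of_type_algebra[OF assms]
  assume ind: "lin_indep K (length Us) ((!) Us)"
  show "independent K Us"
  proof (rule trivial_combine_imp_independent[OF sf])
    fix Ks assume Ks: "set Ks \<subseteq> K" "combine Ks Us = \<zero>\<^bsub>ring_of_type_algebra\<^esub>"
    \<comment> \<open>\<open>Ks\<close> may be longer or shorter than \<open>Us\<close>.
      \<open>combine\<close> ignores surplus coefficients and treats missing ones as zero, so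
      cutting and padding to the length of \<open>Us\<close> keeps the value.\<close>
    define Ks' where "Ks' = take (length Us) Ks @ replicate (length Us - length Ks) 0"
    have l: "length Ks' = length Us" by (auto simp: Ks'_def)
    have "combine Ks' Us = combine (take (length Us) Ks) Us"
      unfolding Ks'_def using combine_append_replicate[of Us] by simp
    also have "\<dots> = 0" using Ks by (simp add: combine_take)
    finally have "(\<Sum>i<length Us. Ks' ! i * Us ! i) = 0" using combine_eq[OF l] by simp
    moreover have "Ks' ! i \<in> K" if "i < length Us" for i
      using that Ks(1) subring_setD(2)[OF subfield_setD(1)[OF assms]]
      by (auto simp: Ks'_def nth_append)
    ultimately have z: "Ks' ! i = 0" if "i < length Us" for i
      using ind that unfolding lin_indep_def by blast
    show "set (take (length Us) Ks) \<subseteq> {\<zero>\<^bsub>ring_of_type_algebra\<^esub>}"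
    proof
      fix x assume "x \<in> set (take (length Us) Ks)"
      then obtain i where "i < length Us" "i < length Ks" "x = Ks ! i"
        by (auto simp: in_set_conv_nth)
      with z[of i] show "x \<in> {\<zero>\<^bsub>ring_of_type_algebra\<^esub>}"
        by (auto simp: Ks'_def nth_append)
    qed
  qed auto
qed

private lemma Span_eq:
  fixes K :: "'a::field set"
  assumes "subfield_set K"
  shows "Span K Us = lin_span K (length Us) ((!) Us)"
proof -
  note sf = subfield_ring_of_type_algebra[OF assms]
  have "Span K Us = {combine Ks Us | Ks. length Ks = length Us \<and> set Ks \<subseteq> K}"
    by (rule Span_eq_combine_set_length_version[OF sf]) auto
  also have "\<dots> = lin_span K (length Us) ((!) Us)"
    unfolding lin_span_def
  proof (intro equalityI subsetI; clarify)
    fix Ks assume "length Ks = length Us" "set Ks \<subseteq> K"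
    thus "\<exists>c. combine Ks Us = (\<Sum>i<length Us. c i * Us ! i) \<and> (\<forall>i<length Us. c i \<in> K)"
      by (intro exI[of _ "(!) Ks"]) (auto simp: combine_eq)
  next
    fix c assume "\<forall>i<length Us. c i \<in> K"
    thus "\<exists>Ks. (\<Sum>i<length Us. c i * Us ! i) = combine Ks Us \<and> length Ks = length Us \<and> set Ks \<subseteq> K"
      by (intro exI[of _ "map c [0..<length Us]"]) (auto simp: combine_eq)
  qed
  finally show ?thesis .
qed

lemma lin_indep_cong: "(\<And>i. i < n \<Longrightarrow> b i = b' i) \<Longrightarrow> lin_indep K n b = lin_indep K n (b' :: nat \<Rightarrow> 'a::field)"
proof -
  assume "\<And>i. i < n \<Longrightarrow> b i = b' i"
  hence "(\<Sum>i<n. c i * b i) = (\<Sum>i<n. c i * b' i)" for c by (intro sum.cong) auto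
  thus ?thesis by (simp add: lin_indep_def)
qed

lemma lin_span_cong: "(\<And>i. i < n \<Longrightarrow> b i = b' i) \<Longrightarrow> lin_span K n b = lin_span K n (b' :: nat \<Rightarrow> 'a::field)"
proof -
  assume "\<And>i. i < n \<Longrightarrow> b i = b' i"
  hence "(\<Sum>i<n. c i * b i) = (\<Sum>i<n. c i * b' i)" for c by (intro sum.cong) auto
  thus ?thesis by (simp add: lin_span_def)
qed

private lemma list_of_family:
  fixes K :: "'a::field set"
  assumes "subfield_set K"
  shows "independent K (map b [0..<n]) \<longleftrightarrow> lin_indep K n b"
    and "Span K (map b [0..<n]) = lin_span K n b"
  using lin_indep_cong[of n "(!) (map b [0..<n])" b K] lin_span_cong[of n "(!) (map b [0..<n])" b K]
  by (simp_all add: independent_iff[OF assms] Span_eq[OF assms] del: Span.simps)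

text \<open>The bridge to \<open>ring.dimension\<close>: with it \<open>dimension_iff\<close> below
  is proved by working with families alone.\<close>

lemma dimension_iff_basis:
  fixes K :: "'a::field set"
  assumes "subfield_set K"
  shows "ring.dimension ring_of_type_algebra n K E \<longleftrightarrow> (\<exists>b. lin_indep K n b \<and> lin_span K n b = E)"
proof
  assume "dimension n K E"
  then obtain Vs where "independent K Vs" "length Vs = n" "Span K Vs = E"
    using exists_base[OF subfield_ring_of_type_algebra[OF assms]] by blast
  thus "\<exists>b. lin_indep K n b \<and> lin_span K n b = E"
    using independent_iff[OF assms, of Vs] Span_eq[OF assms, of Vs] by auto
next
  assume "\<exists>b. lin_indep K n b \<and> lin_span K n b = E"
  then obtain b where "lin_indep K n b" "lin_span K n b = E" by blast
  thus "dimension n K E"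
    using dimensionI[OF subfield_ring_of_type_algebra[OF assms], of "map b [0..<n]" E]
      list_of_family[OF assms, of b n]
    by (simp del: Span.simps)
qed

text \<open>The Steinitz bound, inherited from \<open>independent_length_le\<close>.\<close>

lemma lin_indep_le:
  fixes K :: "'a::field set"
  assumes "subfield_set K" "lin_indep K n b" "lin_indep K m v" "\<And>i. i < m \<Longrightarrow> v i \<in> lin_span K n b"
  shows "m \<le> n"
proof -
  have "set (map v [0..<m]) \<subseteq> Span K (map b [0..<n])"
    using assms(4) by (auto simp: list_of_family[OF assms(1)] simp del: Span.simps)
  thus ?thesis
    using independent_length_le[OF subfield_ring_of_type_algebra[OF assms(1)],
        of "map v [0..<m]" "map b [0..<n]"] assms(2,3)
    by (simp add: list_of_family[OF assms(1)] del: Span.simps)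
qed

lemma lin_indep_Suc:
  fixes K :: "'a::field set"
  assumes "subfield_set K" "lin_indep K n b" "v \<notin> lin_span K n b"
  shows "lin_indep K (Suc n) (b(n := v))"
proof -
  have "independent K (v # map b [0..<n])"
    using assms(2,3) by (intro li_Cons) (auto simp: list_of_family[OF assms(1)] simp del: Span.simps)
  hence *: "lin_indep K (Suc n) ((!) (v # map b [0..<n]))"
    by (simp add: independent_iff[OF assms(1)])
  show ?thesis unfolding lin_indep_def
  proof (intro allI impI)
    fix c i assume c: "(\<forall>i<Suc n. c i \<in> K) \<and> (\<Sum>i<Suc n. c i * (b(n := v)) i) = 0" and i: "i < Suc n"
    \<comment> \<open>The list has \<open>v\<close> at its head, the family has it at index
      \<open>n\<close>; \<open>c'\<close> moves the coefficient of \<open>v\<close> to the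
      front.\<close>
    define c' where "c' j = (case j of 0 \<Rightarrow> c n | Suc j \<Rightarrow> c j)" for j
    have "(\<Sum>i<n. c i * (b(n := v)) i) = (\<Sum>i<n. c i * b i)" by (intro sum.cong) auto
    hence "c n * v + (\<Sum>i<n. c i * b i) = 0" using c by (simp add: add.commute)
    hence "(\<Sum>j<Suc n. c' j * (v # map b [0..<n]) ! j) = 0"
      by (simp add: sum.lessThan_Suc_shift c'_def del: sum.lessThan_Suc)
    moreover have "\<forall>j<Suc n. c' j \<in> K" using c by (auto simp: c'_def split: nat.splits)
    ultimately have z: "\<forall>j<Suc n. c' j = 0" using * unfolding lin_indep_def by blast
    show "c i = 0"
    proof (cases "i = n")
      case True thus ?thesis using z[rule_format, of 0] by (simp add: c'_def)
    next
      case False thus ?thesis using i z[rule_format, of "Suc i"] by (simp add: c'_def)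
    qed
  qed
qed

end

section \<open>Polynomials over a subring and finite-dimensional spans\<close>

definition polys_over :: "'a::comm_ring_1 set \<Rightarrow> 'a poly set" where
  "polys_over A = {p. \<forall>i. coeff p i \<in> A}"

lemma subring_polys_over:
  assumes "subring_set A"
  shows "subring_set (polys_over A)"
  unfolding subring_set_def polys_over_def
  using subring_setD[OF assms]
  by (auto simp: coeff_mult one_pCons coeff_pCons intro!: subring_set_sum[OF assms] split: nat.splits)

text \<open>This set is the ring \<open>A[t]\<close>; it is closed because evaluation at
  \<open>t\<close> is a ring homomorphism.\<close>

lemma subring_poly_values:
  assumes "subring_set A"
  shows "subring_set ((\<lambda>p. poly p t) ` polys_over A)"
proof -
  note D = subring_setD[OF subring_polys_over[OF assms]]
  show ?thesis unfolding subring_set_def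
    by (auto intro: D image_eqI[where x = 1] simp flip: poly_diff poly_mult)
qed

lemma lin_span_closed:
  assumes K: "subfield_set (K :: 'a::field set)"
  shows "0 \<in> lin_span K n b"
    "x \<in> lin_span K n b \<Longrightarrow> y \<in> lin_span K n b \<Longrightarrow> x + y \<in> lin_span K n b"
    "c \<in> K \<Longrightarrow> x \<in> lin_span K n b \<Longrightarrow> c * x \<in> lin_span K n b"
    "i < n \<Longrightarrow> b i \<in> lin_span K n b"
proof -
  note D = subring_setD[OF subfield_setD(1)[OF K]]
  show "0 \<in> lin_span K n b" unfolding lin_span_def using D(2) by (auto intro!: exI[of _ "\<lambda>_. 0"])
  show "x + y \<in> lin_span K n b" if xy: "x \<in> lin_span K n b" "y \<in> lin_span K n b" for x y
  proof -
    obtain c d where "x = (\<Sum>i<n. c i * b i)" "\<forall>i<n. c i \<in> K" "y = (\<Sum>i<n. d i * b i)" "\<forall>i<n. d i \<in> K"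
      using xy unfolding lin_span_def by auto
    thus ?thesis unfolding lin_span_def
      by (auto intro!: exI[of _ "\<lambda>i. c i + d i"] D(4) simp: algebra_simps sum.distrib)
  qed
  show "c * x \<in> lin_span K n b" if cx: "c \<in> K" "x \<in> lin_span K n b" for c x
  proof -
    obtain d where "x = (\<Sum>i<n. d i * b i)" "\<forall>i<n. d i \<in> K"
      using cx unfolding lin_span_def by auto
    thus ?thesis unfolding lin_span_def using cx
      by (auto intro!: exI[of _ "\<lambda>i. c * d i"] D(6) simp: sum_distrib_left mult.assoc)
  qed
  show "b i \<in> lin_span K n b" if "i < n"
    unfolding lin_span_def using that D(1,2)
    by (auto intro!: exI[of _ "\<lambda>j. if j = i then 1 else 0"] simp: if_distrib[of "\<lambda>x. x * _"] cong: if_cong)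
qed

lemma lin_span_sum:
  assumes "subfield_set K" "\<And>i. i \<in> I \<Longrightarrow> g i \<in> lin_span K n b"
  shows "sum g I \<in> lin_span K n b"
  using assms(2) by (induction I rule: infinite_finite_induct) (auto intro: lin_span_closed[OF assms(1)])

lemma lin_span_min:
  assumes "subring_set M" "K \<subseteq> M" "\<And>i. i < n \<Longrightarrow> b i \<in> M"
  shows "lin_span K n b \<subseteq> M"
  using assms(2,3) unfolding lin_span_def
  by (auto intro!: subring_set_sum[OF assms(1)] subring_setD[OF assms(1)])

text \<open>Multiplication by a nonzero element is an injective endomorphism of a finite-dimensional
  algebra without zero divisors, hence surjective.\<close>

lemma inverse_in_lin_span:
  assumes K: "subfield_set (K :: 'a::field set)" and ind: "lin_indep K n b"
    and one: "1 \<in> lin_span K n b"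
    and mult: "\<And>x y. x \<in> lin_span K n b \<Longrightarrow> y \<in> lin_span K n b \<Longrightarrow> x * y \<in> lin_span K n b"
    and x: "x \<in> lin_span K n b"
  shows "inverse x \<in> lin_span K n b"
proof (cases "x = 0")
  case False
  define v where "v i = x * b i" for i
  have v: "(\<Sum>i<n. c i * v i) = x * (\<Sum>i<n. c i * b i)" for c
    by (simp add: v_def sum_distrib_left mult_ac)
  have indv: "lin_indep K n v"
    using ind False unfolding lin_indep_def v by simp
  \<comment> \<open>Otherwise \<open>1\<close> would extend the vectors \<open>v i\<close> to
    \<open>n + 1\<close> independent elements of a space spanned by \<open>n\<close>
    vectors.\<close>
  have "1 \<in> lin_span K n v"
  proof (rule ccontr)
    assume "1 \<notin> lin_span K n v"
    hence "lin_indep K (Suc n) (v(n := 1))" by (rule lin_indep_Suc[OF K indv])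
    moreover have "(v(n := 1)) i \<in> lin_span K n b" if "i < Suc n" for i
      using that one by (auto simp: v_def intro!: mult x lin_span_closed(4)[OF K])
    ultimately have "Suc n \<le> n" using lin_indep_le[OF K ind] by blast
    thus False by simp
  qed
  then obtain c where "1 = x * (\<Sum>i<n. c i * b i)" "\<forall>i<n. c i \<in> K"
    unfolding lin_span_def v by auto
  hence "inverse x = (\<Sum>i<n. c i * b i)" "\<forall>i<n. c i \<in> K"
    using False by (auto simp: field_simps)
  thus ?thesis unfolding lin_span_def by auto
qed (simp add: lin_span_closed[OF K])

text \<open>The two fraction assumptions, with \<open>t\<close> in \<open>K'\<close>, say that
  \<open>K' = K(t)\<close> and \<open>L' = L(t)\<close>. The element \<open>t\<close> is
  transcendental over the larger field \<open>L\<close>.\<close>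

locale transcendental_extension =
  fixes K L K' L' :: "'a::field set" and t :: 'a
  assumes subfields: "subfield_set K" "subfield_set L" "subfield_set K'" "subfield_set L'"
    and subsets: "K \<subseteq> L" "K \<subseteq> K'" "L \<subseteq> L'" "K' \<subseteq> L'"
    and t: "t \<in> K'"
    and fractions_K: "x \<in> K' \<Longrightarrow> \<exists>p\<in>polys_over K. \<exists>q\<in>polys_over K. poly q t \<noteq> 0 \<and> x = poly p t / poly q t"
    and fractions_L: "x \<in> L' \<Longrightarrow> \<exists>p\<in>polys_over L. \<exists>q\<in>polys_over L. poly q t \<noteq> 0 \<and> x = poly p t / poly q t"
    and transcendental: "p \<in> polys_over L \<Longrightarrow> poly p t = 0 \<Longrightarrow> p = 0"
begin

text \<open>Clearing denominators turns a relation over \<open>K'\<close> into one with coefficients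
  \<open>r i\<close> evaluated at \<open>t\<close>, where the \<open>r i\<close> are polynomials
  over \<open>K\<close>. As \<open>t\<close> is transcendental, this holds identically, and
  comparing coefficients gives relations over \<open>K\<close>.\<close>

lemma lin_indep_extend:
  assumes ind: "lin_indep K n b" and b: "\<And>i. i < n \<Longrightarrow> b i \<in> L"
  shows "lin_indep K' n b"
  unfolding lin_indep_def
proof (intro allI impI, elim conjE)
  fix c i assume c: "\<forall>i<n. c i \<in> K'" "(\<Sum>i<n. c i * b i) = 0" and i: "i < n"
  have "\<forall>i\<in>{..<n}. \<exists>pq. fst pq \<in> polys_over K \<and> snd pq \<in> polys_over K \<and> poly (snd pq) t \<noteq> 0
      \<and> c i = poly (fst pq) t / poly (snd pq) t"
    using c(1) fractions_K by fastforce
  then obtain pq where pq: "\<And>i. i < n \<Longrightarrow> fst (pq i) \<in> polys_over K \<and> snd (pq i) \<in> polys_over K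
      \<and> poly (snd (pq i)) t \<noteq> 0 \<and> c i = poly (fst (pq i)) t / poly (snd (pq i)) t"
    by (metis lessThan_iff)
  define q where "q i = snd (pq i)" for i
  define D where "D = (\<Prod>i<n. poly (q i) t)"
  \<comment> \<open>\<open>r i\<close> is the numerator of \<open>c i\<close> over the common
    denominator \<open>D\<close>.\<close>
  define r where "r i = fst (pq i) * (\<Prod>j\<in>{..<n}-{i}. q j)" for i
  have D0: "D \<noteq> 0" using pq by (auto simp: D_def q_def)
  note SK = subring_polys_over[OF subfield_setD(1)[OF subfields(1)]]
  note SL = subring_setD[OF subfield_setD(1)[OF subfields(2)]]
  have rK: "r i \<in> polys_over K" if "i < n" for i
    using pq that by (auto simp: r_def q_def intro!: subring_setD(6)[OF SK] subring_set_prod[OF SK])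
  have r: "poly (r i) t = D * c i" if "i < n" for i
  proof -
    have "D = poly (q i) t * (\<Prod>j\<in>{..<n}-{i}. poly (q j) t)"
      unfolding D_def using that by (subst prod.remove[of _ i]) auto
    thus ?thesis using pq[OF that] by (simp add: r_def poly_prod q_def)
  qed
  \<comment> \<open>The vectors \<open>b i\<close> lie in \<open>L\<close>, so \<open>s\<close> is a
    polynomial over \<open>L\<close>, and transcendence over \<open>L\<close> forces
    \<open>s = 0\<close>.\<close>
  define s where "s = (\<Sum>i<n. smult (b i) (r i))"
  have "poly s t = (\<Sum>i<n. D * (c i * b i))"
    unfolding s_def poly_sum by (intro sum.cong) (simp_all add: r)
  hence "poly s t = 0" using c(2) by (simp flip: sum_distrib_left)
  moreover have "s \<in> polys_over L"
    using rK b subsets(1) unfolding polys_over_def s_def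
    by (auto simp: coeff_sum intro!: subring_set_sum[OF subfield_setD(1)[OF subfields(2)]] SL(6))
  ultimately have "s = 0" by (rule transcendental[rotated])
  hence s0: "(\<Sum>i<n. coeff (r i) k * b i) = 0" for k
  proof -
    have "coeff s k = (\<Sum>i<n. coeff (r i) k * b i)" by (simp add: s_def coeff_sum mult.commute)
    with \<open>s = 0\<close> show ?thesis by simp
  qed
  have "coeff (r i) k = 0" for k
    using ind[unfolded lin_indep_def, rule_format, of "\<lambda>i. coeff (r i) k" i] s0[of k] i rK
    by (simp add: polys_over_def)
  hence "r i = 0" by (simp add: poly_eq_iff)
  thus "c i = 0" using r[OF i] D0 by simp
qed

text \<open>The span over \<open>K'\<close> contains \<open>L\<close> and is closed under
  multiplication, hence contains \<open>L[t]\<close>. Being a finite-dimensional algebra without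
  zero divisors it also contains inverses, so it is all of \<open>L(t)\<close>.\<close>

lemma lin_span_extend:
  assumes ind: "lin_indep K n b" and span: "lin_span K n b = L"
  shows "lin_span K' n b = L'"
proof
  let ?V = "lin_span K' n b"
  have b: "b i \<in> L" if "i < n" for i using lin_span_closed(4)[OF subfields(1) that] span by blast
  note ind' = lin_indep_extend[OF ind b]
  note V = lin_span_closed[OF subfields(3)]
  show "?V \<subseteq> L'"
    using b subsets by (intro lin_span_min[OF subfield_setD(1)[OF subfields(4)]]) auto
  have LV: "L \<subseteq> ?V" unfolding span[symmetric] lin_span_def using subsets(2) by blast
  \<comment> \<open>A product need only be checked on the spanning vectors. This is applied first to
    \<open>x\<close> in \<open>L\<close>, where \<open>b i * x\<close> stays in \<open>L\<close>,
    and then to \<open>x\<close> in \<open>?V\<close>.\<close>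
  have comb: "w * x \<in> ?V" if w: "w \<in> ?V" and x: "\<And>i. i < n \<Longrightarrow> b i * x \<in> ?V" for w x
  proof -
    obtain c where c: "w = (\<Sum>i<n. c i * b i)" "\<forall>i<n. c i \<in> K'"
      using w unfolding lin_span_def by auto
    have "w * x = (\<Sum>i<n. c i * (b i * x))" by (simp add: c sum_distrib_right mult.assoc)
    also have "\<dots> \<in> ?V" by (rule lin_span_sum[OF subfields(3)], rule V(3)) (use c(2) x in auto)
    finally show ?thesis .
  qed
  note SL = subring_setD[OF subfield_setD(1)[OF subfields(2)]]
  have VL: "w * x \<in> ?V" if "w \<in> ?V" "x \<in> L" for w x
    using comb[OF that(1)] LV SL(6)[OF b that(2)] by blast
  have VV: "w * x \<in> ?V" if "w \<in> ?V" "x \<in> ?V" for w x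
    using comb[OF that(1), of x] VL[OF that(2) b] by (metis mult.commute)
  have one: "1 \<in> ?V" using LV SL(1) by blast
  have poly: "poly p t \<in> ?V" if "p \<in> polys_over L" for p
  proof -
    have "poly p t = (\<Sum>i\<le>degree p. t ^ i * coeff p i)" by (simp add: poly_altdef mult.commute)
    also have "\<dots> \<in> ?V"
      using that LV by (intro lin_span_sum[OF subfields(3)] V(3))
        (auto simp: polys_over_def intro: subring_set_power[OF subfield_setD(1)[OF subfields(3)] t])
    finally show ?thesis .
  qed
  show "L' \<subseteq> ?V"
  proof
    fix x assume "x \<in> L'"
    then obtain p q where "p \<in> polys_over L" "q \<in> polys_over L" "x = poly p t * inverse (poly q t)"
      using fractions_L by (metis divide_inverse)
    thus "x \<in> ?V" using VV poly inverse_in_lin_span[OF subfields(3) ind' one VV] by auto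
  qed
qed

text \<open>An equivalence for every \<open>d\<close> gives equal values of \<open>ring.dim\<close>
  without first proving that either extension is finite. A basis over \<open>K\<close> stays a basis
  over \<open>K'\<close>. Conversely, independent families in \<open>L\<close> stay independent over
  \<open>K'\<close>, which bounds their length by \<open>d\<close>, so a longest one exists and is a
  basis.\<close>

lemma dimension_iff:
  "ring.dimension ring_of_type_algebra d K L \<longleftrightarrow> ring.dimension ring_of_type_algebra d K' L'"
  unfolding dimension_iff_basis[OF subfields(1)] dimension_iff_basis[OF subfields(3)]
proof
  have b: "b i \<in> L" if "i < n" "lin_span K n b = L" for i n b
    using lin_span_closed(4)[OF subfields(1) that(1)] that(2) by blast
  show "\<exists>b. lin_indep K' d b \<and> lin_span K' d b = L'"
    if "\<exists>b. lin_indep K d b \<and> lin_span K d b = L"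
    using that lin_indep_extend lin_span_extend b by metis
  show "\<exists>b. lin_indep K d b \<and> lin_span K d b = L"
    if "\<exists>b. lin_indep K' d b \<and> lin_span K' d b = L'"
  proof -
    from that obtain b' where b': "lin_indep K' d b'" "lin_span K' d b' = L'" by blast
    define S where "S = {m. \<exists>v. lin_indep K m v \<and> (\<forall>i<m. v i \<in> L)}"
    have le: "m \<le> d" if "m \<in> S" for m
    proof -
      from that obtain v where v: "lin_indep K m v" "\<forall>i<m. v i \<in> L" by (auto simp: S_def)
      have "lin_indep K' m v" by (rule lin_indep_extend) (use v in auto)
      thus ?thesis using v subsets(3) by (intro lin_indep_le[OF subfields(3) b'(1)]) (auto simp: b'(2))
    qed
    have "0 \<in> S" by (auto simp: S_def lin_indep_def)
    moreover have fin: "finite S" using le by (auto intro: finite_subset[of _ "{..d}"])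
    ultimately have "Max S \<in> S" by (intro Max_in) auto
    then obtain n v where n: "n = Max S" and v: "lin_indep K n v" "\<forall>i<n. v i \<in> L"
      by (auto simp: S_def)
    have "lin_span K n v = L"
    proof
      show "lin_span K n v \<subseteq> L"
        using v subsets by (intro lin_span_min[OF subfield_setD(1)[OF subfields(2)]]) auto
      \<comment> \<open>A vector outside the span would give an independent family longer than the
        maximum.\<close>
      show "L \<subseteq> lin_span K n v"
      proof
        fix x assume x: "x \<in> L"
        show "x \<in> lin_span K n v"
        proof (rule ccontr)
          assume "x \<notin> lin_span K n v"
          hence "lin_indep K (Suc n) (v(n := x))" by (rule lin_indep_Suc[OF subfields(1) v(1)])
          moreover have "\<forall>i<Suc n. (v(n := x)) i \<in> L" using v(2) x by auto
          ultimately have "Suc n \<in> S" by (auto simp: S_def)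
          thus False using Max_ge[OF fin] n by fastforce
        qed
      qed
    qed
    note v = v this
    have v': "lin_indep K' n v" "lin_span K' n v = L'"
      using lin_indep_extend[OF v(1)] lin_span_extend[OF v(1,3)] v(2) by auto
    \<comment> \<open>Both \<open>v\<close> and \<open>b'\<close> are now bases of \<open>L'\<close>
      over \<open>K'\<close>.\<close>
    have "d \<le> n" "n \<le> d"
      using lin_indep_le[OF subfields(3) v'(1) b'(1)] lin_indep_le[OF subfields(3) b'(1) v'(1)]
        lin_span_closed(4)[OF subfields(3), of _ n v] lin_span_closed(4)[OF subfields(3), of _ d b'] v'(2) b'(2)
      by auto
    thus ?thesis using v by auto
  qed
qed

end

section \<open>Substitution and forms\<close>

definition subst_monom :: "(nat \<Rightarrow> 'a::comm_ring_1) \<Rightarrow> cmonom \<Rightarrow> 'a" where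
  "subst_monom x m = (\<Prod>i\<in>Poly_Mapping.keys m. x i ^ Poly_Mapping.lookup m i)"

lemma subst_monom_superset:
  assumes "finite A" "Poly_Mapping.keys m \<subseteq> A"
  shows "subst_monom x m = (\<Prod>i\<in>A. x i ^ Poly_Mapping.lookup m i)"
  unfolding subst_monom_def using assms
  by (intro prod.mono_neutral_left) (auto simp: in_keys_iff)

lemma monom_deg_superset:
  assumes "finite A" "Poly_Mapping.keys m \<subseteq> A"
  shows "monom_deg m = (\<Sum>i\<in>A. Poly_Mapping.lookup m i)"
  unfolding monom_deg_def using assms
  by (intro sum.mono_neutral_left) (auto simp: in_keys_iff)

lemma subst_monom_add: "subst_monom x (m + m') = subst_monom x m * subst_monom x m'"
proof -
  let ?A = "Poly_Mapping.keys m \<union> Poly_Mapping.keys m'"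
  have "Poly_Mapping.keys (m + m') \<subseteq> ?A" by (rule keys_add)
  thus ?thesis
    by (simp add: subst_monom_superset[of ?A] lookup_add power_add prod.distrib)
qed

lemma monom_deg_add: "monom_deg (m + m') = monom_deg m + monom_deg m'"
proof -
  let ?A = "Poly_Mapping.keys m \<union> Poly_Mapping.keys m'"
  have "Poly_Mapping.keys (m + m') \<subseteq> ?A" by (rule keys_add)
  thus ?thesis
    by (simp add: monom_deg_superset[of ?A] lookup_add sum.distrib)
qed

lemma subst_poly_superset:
  assumes "c 0 = 0" "finite A" "Poly_Mapping.keys p \<subseteq> A"
  shows "subst_poly c x p = (\<Sum>m\<in>A. c (Poly_Mapping.lookup p m) * subst_monom x m)"
  unfolding subst_poly_def subst_monom_def[symmetric] using assms
  by (intro sum.mono_neutral_left) (auto simp: in_keys_iff)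

lemma poly_mapping_eq_sum_single:
  "p = (\<Sum>m\<in>Poly_Mapping.keys p. Poly_Mapping.single m (Poly_Mapping.lookup p m))"
  by (rule poly_mapping_eqI) (auto simp: lookup_sum lookup_single when_def in_keys_iff)

text \<open>Only the actual terms of \<open>p\<close> occur in the monomial case, so bounds on its
  degrees and variables remain available there; \<open>forms_in_induct\<close> rests on
  this.\<close>

lemma poly_mapping_single_induct [case_names zero single add]:
  fixes p :: "'a \<Rightarrow>\<^sub>0 'b::comm_monoid_add"
  assumes "P 0" "\<And>m. m \<in> Poly_Mapping.keys p \<Longrightarrow> P (Poly_Mapping.single m (Poly_Mapping.lookup p m))"
    "\<And>p q. P p \<Longrightarrow> P q \<Longrightarrow> P (p + q)"
  shows "P p"
proof -
  have "P (\<Sum>m\<in>M. Poly_Mapping.single m (Poly_Mapping.lookup p m))"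
    if "M \<subseteq> Poly_Mapping.keys p" for M
    using that by (induction M rule: infinite_finite_induct) (auto intro: assms)
  from this[OF subset_refl] show ?thesis by (simp only: poly_mapping_eq_sum_single[of p, symmetric])
qed

lemma subst_poly_cong:
  assumes "\<And>i. i \<in> poly_vars p \<Longrightarrow> x i = y i"
  shows "subst_poly c x p = subst_poly c y p"
proof -
  have "x i = y i" if "m \<in> Poly_Mapping.keys p" "i \<in> Poly_Mapping.keys m" for m i
    using assms that by (auto simp: poly_vars_def)
  thus ?thesis unfolding subst_poly_def by simp
qed

text \<open>Applied with \<open>h\<close> a further substitution it gives the composition law, and
  with \<open>h\<close> the evaluation of a one-variable polynomial it gives restriction to
  lines.\<close>

lemma subst_poly_image:
  assumes "h 0 = 0" "h 1 = 1" "\<And>a b. h (a + b) = h a + h b" "\<And>a b. h (a * b) = h a * h b"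
  shows "h (subst_poly c x p) = subst_poly (\<lambda>a. h (c a)) (\<lambda>i. h (x i)) p"
proof -
  have pow: "h (a ^ k) = h a ^ k" for a k by (induction k) (simp_all add: assms)
  have s: "h (sum g I) = (\<Sum>i\<in>I. h (g i))" for g and I :: "cmonom set"
    by (induction I rule: infinite_finite_induct) (simp_all add: assms)
  have p: "h (prod g I) = (\<Prod>i\<in>I. h (g i))" for g and I :: "nat set"
    by (induction I rule: infinite_finite_induct) (simp_all add: assms)
  show ?thesis unfolding subst_poly_def by (simp add: s p pow assms)
qed

text \<open>\<open>compose_poly\<close> and \<open>eval_poly\<close> differ only in the coefficient
  map; the locale gives the homomorphism laws for both.\<close>

locale coeff_hom =
  fixes c :: "complex \<Rightarrow> 'a::comm_ring_1"
  assumes c_0: "c 0 = 0" and c_1: "c 1 = 1"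
    and c_add: "c (a + b) = c a + c b" and c_mult: "c (a * b) = c a * c b"
begin

lemma subst_0 [simp]: "subst_poly c x 0 = 0"
  by (simp add: subst_poly_def)

lemma subst_single: "subst_poly c x (Poly_Mapping.single m a) = c a * subst_monom x m"
  by (subst subst_poly_superset[of _ "{m}"]) (auto simp: c_0)

lemma subst_const [simp]: "subst_poly c x (const_poly a) = c a"
  by (simp add: const_poly_def subst_single subst_monom_def)

lemma subst_1 [simp]: "subst_poly c x 1 = 1"
  using subst_const[of x 1] by (simp add: const_poly_def c_1)

lemma subst_coord [simp]: "subst_poly c x (coord_poly i) = x i"
  by (simp add: coord_poly_def subst_single subst_monom_def c_1)

lemma subst_add: "subst_poly c x (p + q) = subst_poly c x p + subst_poly c x q"
proof -
  let ?A = "Poly_Mapping.keys p \<union> Poly_Mapping.keys q"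
  have "Poly_Mapping.keys (p + q) \<subseteq> ?A" by (rule keys_add)
  thus ?thesis
    by (simp add: subst_poly_superset[of _ ?A] c_0 lookup_add c_add sum.distrib algebra_simps)
qed

lemma subst_uminus: "subst_poly c x (- p) = - subst_poly c x p"
  using subst_add[of x p "- p"] by (simp add: eq_neg_iff_add_eq_0 add.commute)

lemma subst_diff: "subst_poly c x (p - q) = subst_poly c x p - subst_poly c x q"
  using subst_add[of x p "- q"] by (simp add: subst_uminus)

lemma subst_mult: "subst_poly c x (p * q) = subst_poly c x p * subst_poly c x q"
proof (induction p rule: poly_mapping_single_induct)
  case (single m)
  show ?case
  proof (induction q rule: poly_mapping_single_induct)
    case (single m')
    show ?case by (simp add: mult_single subst_single subst_monom_add c_mult mult_ac)
  qed (simp_all add: subst_add distrib_left)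
qed (simp_all add: subst_add distrib_right)

lemma subst_compose:
  "subst_poly c x (compose_poly p F) = subst_poly c (\<lambda>i. subst_poly c x (F i)) p"
  unfolding compose_poly_def
  by (subst subst_poly_image) (simp_all add: subst_add subst_mult)

end

interpretation const_hom: coeff_hom const_poly
  by unfold_locales (simp_all add: const_poly_def single_add mult_single)

interpretation eval_hom: coeff_hom "\<lambda>c::complex. c"
  by unfold_locales simp_all

lemmas compose_simps = const_hom.subst_0 const_hom.subst_1 const_hom.subst_const const_hom.subst_coord
  const_hom.subst_add const_hom.subst_uminus const_hom.subst_diff const_hom.subst_mult

lemmas compose_poly_simps [simp] = compose_simps[folded compose_poly_def]

lemmas eval_simps = eval_hom.subst_0 eval_hom.subst_1 eval_hom.subst_const eval_hom.subst_coord
  eval_hom.subst_add eval_hom.subst_uminus eval_hom.subst_diff eval_hom.subst_mult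

lemmas eval_poly_simps [simp] = eval_simps[folded eval_poly_def]

lemma compose_poly_assoc: "compose_poly (compose_poly p F) H = compose_poly p (\<lambda>i. compose_poly (F i) H)"
  using const_hom.subst_compose[of H p F] by (simp add: compose_poly_def)

lemma eval_compose: "eval_poly (compose_poly p F) x = eval_poly p (\<lambda>i. eval_poly (F i) x)"
  using eval_hom.subst_compose[of x p F] by (simp add: eval_poly_def)

lemma compose_poly_cong: "(\<And>i. i \<in> poly_vars p \<Longrightarrow> F i = H i) \<Longrightarrow> compose_poly p F = compose_poly p H"
  unfolding compose_poly_def by (rule subst_poly_cong)

lemma eval_poly_cong: "(\<And>i. i \<in> poly_vars p \<Longrightarrow> x i = y i) \<Longrightarrow> eval_poly p x = eval_poly p y"
  unfolding eval_poly_def by (rule subst_poly_cong)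

lemma single_eq_const_monom: "Poly_Mapping.single m a = const_poly a * monom_poly m"
  by (simp add: const_poly_def monom_poly_def mult_single)

lemma monom_poly_add: "monom_poly (m + m') = monom_poly m * monom_poly m'"
  by (simp add: monom_poly_def mult_single)

lemma subst_monom_coord: "subst_monom coord_poly m = monom_poly m"
proof -
  have pow: "coord_poly i ^ k = monom_poly (Poly_Mapping.single i k)" for i k
    by (induction k) (simp_all add: coord_poly_def monom_poly_def mult_single flip: single_add)
  have "(\<Prod>i\<in>A. monom_poly (g i)) = monom_poly (sum g A)" for A :: "nat set" and g
    by (induction A rule: infinite_finite_induct) (simp_all add: monom_poly_add, simp_all add: monom_poly_def)
  hence "subst_monom coord_poly m
      = monom_poly (\<Sum>i\<in>Poly_Mapping.keys m. Poly_Mapping.single i (Poly_Mapping.lookup m i))"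
    by (simp add: subst_monom_def pow)
  thus ?thesis by (simp only: poly_mapping_eq_sum_single[symmetric])
qed

lemma compose_coord [simp]: "compose_poly p coord_poly = p"
proof (induction p rule: poly_mapping_single_induct)
  case (single m)
  show ?case
    unfolding compose_poly_def const_hom.subst_single subst_monom_coord
    by (simp add: single_eq_const_monom)
qed simp_all

text \<open>An arbitrary set \<open>V\<close> in place of \<open>{..N}\<close> permits inductions
  that remove one variable at a time.\<close>

definition forms_in :: "nat set \<Rightarrow> nat \<Rightarrow> cpoly set" where
  "forms_in V d = {p. poly_vars p \<subseteq> V \<and> (\<forall>m\<in>Poly_Mapping.keys p. monom_deg m = d)}"

lemma forms_eq: "forms N = forms_in {..N}"
  by (simp add: fun_eq_iff forms_def forms_in_def)

lemma poly_vars_simps [simp]: "poly_vars 0 = {}" "poly_vars 1 = {}" "poly_vars (const_poly a) = {}"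
  "poly_vars (coord_poly i) = {i}" "poly_vars (- p) = poly_vars p"
  "poly_vars (monom_poly m) = Poly_Mapping.keys m"
  by (auto simp: poly_vars_def const_poly_def coord_poly_def monom_poly_def)

lemma poly_vars_add: "poly_vars (p + q) \<subseteq> poly_vars p \<union> poly_vars q"
  using keys_add[of p q] by (auto simp: poly_vars_def)

lemma poly_vars_mult: "poly_vars (p * q) \<subseteq> poly_vars p \<union> poly_vars q"
proof
  fix i assume "i \<in> poly_vars (p * q)"
  then obtain m where m: "m \<in> Poly_Mapping.keys (p * q)" "i \<in> Poly_Mapping.keys m"
    by (auto simp: poly_vars_def)
  then obtain a b where "m = a + b" "a \<in> Poly_Mapping.keys p" "b \<in> Poly_Mapping.keys q"
    using keys_mult[of p q] by auto
  thus "i \<in> poly_vars p \<union> poly_vars q"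
    using m(2) keys_add[of a b] by (auto simp: poly_vars_def)
qed

lemma forms_in_simps [simp]: "0 \<in> forms_in V d" "1 \<in> forms_in V 0" "const_poly a \<in> forms_in V 0"
  "i \<in> V \<Longrightarrow> coord_poly i \<in> forms_in V (Suc 0)"
  by (auto simp: forms_in_def poly_vars_def const_poly_def coord_poly_def monom_deg_def)

lemma forms_in_monom: "Poly_Mapping.keys m \<subseteq> V \<Longrightarrow> monom_deg m = d \<Longrightarrow> monom_poly m \<in> forms_in V d"
  by (auto simp: forms_in_def poly_vars_def monom_poly_def)

lemma forms_in_uminus: "p \<in> forms_in V d \<Longrightarrow> - p \<in> forms_in V d"
  by (simp add: forms_in_def)

lemma forms_in_add: "p \<in> forms_in V d \<Longrightarrow> q \<in> forms_in V d \<Longrightarrow> p + q \<in> forms_in V d"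
  using poly_vars_add[of p q] keys_add[of p q] by (auto simp: forms_in_def)

lemma forms_in_diff: "p \<in> forms_in V d \<Longrightarrow> q \<in> forms_in V d \<Longrightarrow> p - q \<in> forms_in V d"
  using forms_in_add[of p V d "- q"] forms_in_uminus[of q V d] by simp

lemma forms_in_mult:
  assumes "p \<in> forms_in V d" "q \<in> forms_in V e"
  shows "p * q \<in> forms_in V (d + e)"
  unfolding forms_in_def
proof (intro CollectI conjI ballI)
  show "poly_vars (p * q) \<subseteq> V"
    using poly_vars_mult[of p q] assms by (auto simp: forms_in_def)
  fix m assume "m \<in> Poly_Mapping.keys (p * q)"
  then obtain a b where "m = a + b" "a \<in> Poly_Mapping.keys p" "b \<in> Poly_Mapping.keys q"
    using keys_mult[of p q] by auto
  thus "monom_deg m = d + e"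
    using assms by (simp add: forms_in_def monom_deg_add)
qed

lemma forms_in_mono: "V \<subseteq> Y \<Longrightarrow> forms_in V d \<subseteq> forms_in Y d"
  by (auto simp: forms_in_def)

lemma forms_in_vars: "p \<in> forms_in V d \<Longrightarrow> poly_vars p \<subseteq> V"
  by (simp add: forms_in_def)

lemma forms_in_induct [consumes 1, case_names zero monom add]:
  assumes "p \<in> forms_in V d" "P 0"
    "\<And>m a. Poly_Mapping.keys m \<subseteq> V \<Longrightarrow> monom_deg m = d \<Longrightarrow> P (const_poly a * monom_poly m)"
    "\<And>p q. P p \<Longrightarrow> P q \<Longrightarrow> P (p + q)"
  shows "P p"
proof (rule poly_mapping_single_induct)
  fix m assume "m \<in> Poly_Mapping.keys p"
  hence "Poly_Mapping.keys m \<subseteq> V" "monom_deg m = d"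
    using assms(1) by (auto simp: forms_in_def poly_vars_def)
  thus "P (Poly_Mapping.single m (Poly_Mapping.lookup p m))"
    unfolding single_eq_const_monom by (rule assms(3))
qed (fact assms)+

lemma forms_in_power: "p \<in> forms_in V d \<Longrightarrow> p ^ k \<in> forms_in V (k * d)"
  by (induction k) (auto intro: forms_in_mult)

lemma forms_in_prod:
  "(\<And>i. i \<in> I \<Longrightarrow> g i \<in> forms_in V (d i)) \<Longrightarrow> prod g I \<in> forms_in V (sum d I)"
  by (induction I rule: infinite_finite_induct) (auto intro: forms_in_mult)

lemma compose_monom: "compose_poly (monom_poly m) F = subst_monom F m"
  by (simp add: compose_poly_def monom_poly_def const_hom.subst_single const_hom.c_1)

lemma forms_in_compose:
  assumes "p \<in> forms_in V d" "\<And>i. i \<in> V \<Longrightarrow> F i \<in> forms_in Y e"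
  shows "compose_poly p F \<in> forms_in Y (d * e)"
  using assms(1)
proof (induction rule: forms_in_induct)
  case (monom m a)
  have "subst_monom F m \<in> forms_in Y (\<Sum>i\<in>Poly_Mapping.keys m. Poly_Mapping.lookup m i * e)"
    unfolding subst_monom_def using monom assms(2)
    by (intro forms_in_prod forms_in_power) auto
  also have "(\<Sum>i\<in>Poly_Mapping.keys m. Poly_Mapping.lookup m i * e) = d * e"
    using monom by (simp add: monom_deg_def flip: sum_distrib_right)
  finally show ?case using forms_in_mult[of "const_poly a" Y 0] by (simp add: compose_monom)
qed (auto intro: forms_in_add)

section \<open>Dominance as independence\<close>

text \<open>Each monomial of \<open>p\<close> goes to the second summand if it contains
  \<open>x_j\<close> and to \<open>r\<close> otherwise. The last clause is for \<open>d = 0\<close>,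
  where \<open>d - 1\<close> is \<open>0\<close> again and does not express a drop in
  degree.\<close>

lemma forms_in_insert_decompose:
  assumes "p \<in> forms_in (insert j V) d"
  obtains r q where "p = r + coord_poly j * q" "r \<in> forms_in V d"
    "q \<in> forms_in (insert j V) (d - 1)" "d = 0 \<longrightarrow> q = 0"
proof -
  have "\<exists>r q. p = r + coord_poly j * q \<and> r \<in> forms_in V d \<and> q \<in> forms_in (insert j V) (d - 1) \<and> (d = 0 \<longrightarrow> q = 0)"
    using assms
  proof (induction rule: forms_in_induct)
    case zero
    show ?case by (intro exI[of _ 0]) simp
  next
    case (monom m a)
    show ?case
    proof (cases "j \<in> Poly_Mapping.keys m")
      case False
      hence "const_poly a * monom_poly m \<in> forms_in V (0 + d)"
        using monom by (intro forms_in_mult forms_in_monom) auto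
      thus ?thesis
        by (intro exI[of _ "const_poly a * monom_poly m"] exI[of _ 0]) simp
    next
      case True
      define m' where "m' = m - Poly_Mapping.single j 1"
      have m: "m = Poly_Mapping.single j 1 + m'"
        by (rule poly_mapping_eqI) (use True in \<open>auto simp: m'_def lookup_add lookup_minus lookup_single when_def in_keys_iff\<close>)
      have "monom_deg m = 1 + monom_deg m'"
        unfolding m monom_deg_add by (simp add: monom_deg_def)
      hence d: "monom_deg m' = d - 1" "d \<noteq> 0" using monom by auto
      have "Poly_Mapping.keys m' \<subseteq> Poly_Mapping.keys m"
        by (auto simp: m'_def in_keys_iff lookup_minus)
      hence "const_poly a * monom_poly m' \<in> forms_in (insert j V) (0 + (d - 1))"
        using monom d by (intro forms_in_mult forms_in_monom) auto
      moreover have "const_poly a * monom_poly m = coord_poly j * (const_poly a * monom_poly m')"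
        unfolding m monom_poly_add by (simp add: coord_poly_def monom_poly_def)
      ultimately show ?thesis using d(2)
        by (intro exI[of _ "const_poly a * monom_poly m'"] exI[of _ 0]) simp
    qed
  next
    case (add p p')
    then obtain r q r' q' where "p = r + coord_poly j * q" "p' = r' + coord_poly j * q'"
      "r \<in> forms_in V d" "q \<in> forms_in (insert j V) (d - 1)" "d = 0 \<longrightarrow> q = 0"
      "r' \<in> forms_in V d" "q' \<in> forms_in (insert j V) (d - 1)" "d = 0 \<longrightarrow> q' = 0"
      by blast
    thus ?case
      by (intro exI[of _ "r + r'"] exI[of _ "q + q'"]) (auto simp: algebra_simps intro: forms_in_add)
  qed
  thus ?thesis using that by blast
qed

lemma coord_poly_neq_0 [simp]: "coord_poly i \<noteq> 0"
  by (simp add: coord_poly_def flip: keys_eq_empty)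

lemma univariate_restriction: "\<exists>h. \<forall>s. poly h s = eval_poly p (x(i := s))"
proof -
  define h where "h = subst_poly (\<lambda>c. [:c:]) (\<lambda>j. if j = i then [:0, 1:] else [:x j:]) p"
  have "poly h s = eval_poly p (x(i := s))" for s
    unfolding h_def eval_poly_def
    by (subst subst_poly_image[of "\<lambda>h. poly h s"]) (simp_all add: fun_upd_def if_distrib[of "\<lambda>h. poly h s"] cong: if_cong)
  thus ?thesis by blast
qed

text \<open>Pointwise cancellation fails where \<open>x i = 0\<close>. On each line in direction
  \<open>i\<close>, however, the restriction of \<open>q\<close> times the line parameter vanishes
  everywhere, so the restriction is the zero polynomial.\<close>

lemma eval_zero_of_coord_mult:
  assumes "\<And>x. eval_poly (coord_poly i * q) x = 0"
  shows "eval_poly q x = 0"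
proof -
  obtain h where h: "\<And>s. poly h s = eval_poly q (x(i := s))"
    using univariate_restriction by metis
  have "poly ([:0, 1:] * h) s = 0" for s
    using assms[of "x(i := s)"] h[of s] by simp
  hence "[:0, 1:] * h = 0" using poly_all_0_iff_0 by blast
  hence "h = 0" by simp
  thus ?thesis using h[of "x i"] by simp
qed

text \<open>Induction on the variables and, for each new one, on the degree. Write
  \<open>p = r + x_i q\<close> with \<open>r\<close> free of \<open>x_i\<close>: setting
  \<open>x_i = 0\<close> shows that \<open>r\<close> vanishes everywhere, and then
  \<open>x_i\<close> can be cancelled from the rest.\<close>

lemma form_eq_0_if_eval_eq_0:
  assumes "finite V" "p \<in> forms_in V d" "\<And>x. eval_poly p x = 0"
  shows "p = 0"
  using assms
proof (induction V arbitrary: p d rule: finite_induct)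
  case empty
  have "Poly_Mapping.keys p \<subseteq> {0}"
    using empty(1) by (auto simp: forms_in_def poly_vars_def)
  hence p: "p = const_poly (Poly_Mapping.lookup p 0)"
    by (intro poly_mapping_eqI) (auto simp: const_poly_def lookup_single when_def in_keys_iff)
  have "Poly_Mapping.lookup p 0 = eval_poly (const_poly (Poly_Mapping.lookup p 0)) (\<lambda>_. 0)"
    by simp
  also have "\<dots> = 0" using empty(2) p by metis
  finally show ?case using p const_hom.c_0 by metis
next
  case (insert i V)
  show ?case using insert.prems
  proof (induction d arbitrary: p)
    case (0 p)
    then obtain r q where p: "p = r + coord_poly i * q" "r \<in> forms_in V 0" "q = 0"
      by (auto elim: forms_in_insert_decompose)
    thus ?case using insert.IH[of p 0] 0 by simp
  next
    case (Suc d p)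
    obtain r q where p: "p = r + coord_poly i * q" "r \<in> forms_in V (Suc d)" "q \<in> forms_in (insert i V) d"
      using forms_in_insert_decompose[OF Suc.prems(1)] by (metis diff_Suc_1)
    have "eval_poly r x = 0" for x
    proof -
      have "eval_poly r x = eval_poly r (x(i := 0))"
        using insert.hyps(2) forms_in_vars[OF p(2)] by (intro eval_poly_cong) auto
      also have "\<dots> = 0" using Suc.prems(2)[of "x(i := 0)"] p(1) by (simp add: fun_upd_def)
      finally show ?thesis .
    qed
    hence r: "r = 0" using insert.IH p(2) by blast
    have "eval_poly q x = 0" for x
      by (rule eval_zero_of_coord_mult) (use Suc.prems(2) p(1) r in simp)
    hence "q = 0" using Suc.IH p(3) by blast
    thus ?case using p r by simp
  qed
qed

text \<open>The homogeneous version of algebraic independence: only homogeneous relations are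
  tested, since only these define closed sets in projective space.\<close>

definition indep_forms :: "nat \<Rightarrow> (nat \<Rightarrow> cpoly) \<Rightarrow> bool" where
  "indep_forms N F \<longleftrightarrow> (\<forall>d. \<forall>p\<in>forms N d. compose_poly p F = 0 \<longrightarrow> p = 0)"

text \<open>The zero vector is not a point of projective space. Multiplying by \<open>x_0\<close>
  makes the form vanish there too, and \<open>x_0\<close> is cancelled at the end.\<close>

lemma form_eq_0_if_zero_on_proj_points:
  assumes p: "p \<in> forms N d" and z: "\<And>x. x \<in> proj_points N \<Longrightarrow> eval_poly p x = 0"
  shows "p = 0"
proof -
  have c: "coord_poly 0 \<in> forms N 1" by (simp add: forms_eq)
  have "coord_poly 0 * p = 0"
  proof (rule form_eq_0_if_eval_eq_0)
    show f: "coord_poly 0 * p \<in> forms_in {..N} (1 + d)"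
      using c p unfolding forms_eq by (rule forms_in_mult)
    fix x :: "nat \<Rightarrow> complex"
    define x' where "x' i = (if i \<le> N then x i else 0)" for i
    have "eval_poly (coord_poly 0 * p) x = eval_poly (coord_poly 0 * p) x'"
      using forms_in_vars[OF f] by (intro eval_poly_cong) (auto simp: x'_def)
    also have "\<dots> = 0"
    proof (cases "x 0 = 0")
      case False
      hence "x' \<in> proj_points N" by (auto simp: proj_points_def x'_def)
      thus ?thesis using z by simp
    qed (simp add: x'_def)
    finally show "eval_poly (coord_poly 0 * p) x = 0" .
  qed simp
  thus ?thesis by simp
qed

lemma eval_poly_rat_map:
  assumes "p \<in> forms N d"
  shows "eval_poly p (\<lambda>i. if i \<le> N then eval_poly (F i) x else 0) = eval_poly (compose_poly p F) x"
  unfolding eval_compose using assms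
  by (intro eval_poly_cong) (auto dest!: forms_in_vars simp: forms_eq)

text \<open>A homogeneous relation among the \<open>F i\<close> is an equation satisfied by the
  image. Conversely, an equation of a closed set containing the image becomes such a relation after
  multiplication by \<open>x_0\<close>.\<close>

lemma dominant_iff_indep_forms:
  assumes F: "\<And>i. i \<le> N \<Longrightarrow> F i \<in> forms N e"
  shows "dominant N F \<longleftrightarrow> indep_forms N F"
proof
  assume dom: "dominant N F"
  show "indep_forms N F" unfolding indep_forms_def
  proof (intro allI ballI impI)
    fix d p assume p: "p \<in> forms N d" "compose_poly p F = 0"
    have "{p} \<subseteq> (\<Union>d. forms N d)" using p(1) by auto
    moreover have "rat_map_image N F \<subseteq> proj_zeros N {p}"
      using p by (auto simp: rat_map_image_def proj_zeros_def eval_poly_rat_map)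
    ultimately have "proj_zeros N {p} = proj_points N"
      using dom unfolding dominant_def by blast
    thus "p = 0"
      by (intro form_eq_0_if_zero_on_proj_points[OF p(1)]) (auto simp: proj_zeros_def)
  qed
next
  assume ind: "indep_forms N F"
  show "dominant N F" unfolding dominant_def
  proof (intro allI impI, elim conjE)
    fix S assume S: "S \<subseteq> (\<Union>d. forms N d)" and im: "rat_map_image N F \<subseteq> proj_zeros N S"
    have "p = 0" if pS: "p \<in> S" for p
    proof -
      from pS S obtain d where p: "p \<in> forms N d" by auto
      \<comment> \<open>The factor \<open>x\<^sub>0\<close> takes care of the points where \<open>F\<close> vanishes.\<close>
      have xp: "coord_poly 0 * p \<in> forms N (1 + d)"
        using forms_in_mult[of "coord_poly 0" "{..N}" 1 p d] p by (simp add: forms_eq)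
      have "compose_poly (coord_poly 0 * p) F = 0"
      proof (rule form_eq_0_if_zero_on_proj_points)
        show "compose_poly (coord_poly 0 * p) F \<in> forms N ((1 + d) * e)"
          using xp F unfolding forms_eq by (intro forms_in_compose) auto
        fix x assume x: "x \<in> proj_points N"
        define y where "y = (\<lambda>i. if i \<le> N then eval_poly (F i) x else 0)"
        show "eval_poly (compose_poly (coord_poly 0 * p) F) x = 0"
        proof (cases "y \<in> proj_points N")
          case True
          hence "y \<in> proj_zeros N S" using im x by (auto simp: rat_map_image_def y_def)
          hence "eval_poly p y = 0" using pS by (auto simp: proj_zeros_def)
          thus ?thesis using eval_poly_rat_map[OF p] by (simp add: y_def)
        next
          case False
          hence "y 0 = 0" by (auto simp: proj_points_def y_def)
          thus ?thesis by (simp add: y_def)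
        qed
      qed
      hence "coord_poly 0 * p = 0" using ind xp unfolding indep_forms_def by blast
      thus "p = 0" by simp
    qed
    hence "eval_poly p x = 0" if "p \<in> S" for p x using that eval_poly_simps(1) by metis
    thus "proj_zeros N S = proj_points N" by (auto simp: proj_zeros_def)
  qed
qed

section \<open>Pullback fields\<close>

lemma pullback_field_memI:
  assumes "a \<in> forms N d" "b \<in> forms N d" "compose_poly b F \<noteq> 0"
  shows "to_fract (compose_poly a F) / to_fract (compose_poly b F) \<in> pullback_field N F"
  using assms unfolding pullback_field_def Fract_conv_to_fract by blast

lemma pullback_field_memE:
  assumes "x \<in> pullback_field N F"
  obtains a b d where "a \<in> forms N d" "b \<in> forms N d" "compose_poly b F \<noteq> 0"
    "x = to_fract (compose_poly a F) / to_fract (compose_poly b F)"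
  using assms unfolding pullback_field_def Fract_conv_to_fract by blast

text \<open>\<open>coord_poly\<close> represents the identity map, so facts about pullback fields
  cover function fields as well.\<close>

lemma function_field_eq: "function_field N = pullback_field N coord_poly"
  by (simp add: function_field_def pullback_field_def)

lemma subfield_pullback_field: "subfield_set (pullback_field N F)"
proof -
  note I = pullback_field_memI[where N = N and F = F]
  have one: "1 \<in> pullback_field N F"
    using I[of 1 0 1] by (simp add: forms_eq)
  have "x - y \<in> pullback_field N F \<and> x * y \<in> pullback_field N F"
    if "x \<in> pullback_field N F" "y \<in> pullback_field N F" for x y
  proof -
    obtain a b d where x: "a \<in> forms N d" "b \<in> forms N d" "compose_poly b F \<noteq> 0"
      "x = to_fract (compose_poly a F) / to_fract (compose_poly b F)"
      using \<open>x \<in> _\<close> by (rule pullback_field_memE)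
    obtain a' b' d' where y: "a' \<in> forms N d'" "b' \<in> forms N d'" "compose_poly b' F \<noteq> 0"
      "y = to_fract (compose_poly a' F) / to_fract (compose_poly b' F)"
      using \<open>y \<in> _\<close> by (rule pullback_field_memE)
    have "a * b' - b * a' \<in> forms N (d + d')" "a * a' \<in> forms N (d + d')" "b * b' \<in> forms N (d + d')"
      using x y unfolding forms_eq by (auto intro!: forms_in_mult forms_in_diff)
    moreover have
      "x - y = to_fract (compose_poly (a * b' - b * a') F) / to_fract (compose_poly (b * b') F)"
      using x(3) y(3) by (simp add: x(4) y(4) diff_frac_eq mult.commute)
    moreover have "x * y = to_fract (compose_poly (a * a') F) / to_fract (compose_poly (b * b') F)"
      by (simp add: x(4) y(4))
    ultimately show ?thesis
      using I[of "a * b' - b * a'" "d + d'" "b * b'"] I[of "a * a'" "d + d'" "b * b'"] x(3) y(3)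
      by simp
  qed
  moreover have "inverse x \<in> pullback_field N F" if "x \<in> pullback_field N F" for x
  proof -
    obtain a b d where x: "a \<in> forms N d" "b \<in> forms N d" "compose_poly b F \<noteq> 0"
      "x = to_fract (compose_poly a F) / to_fract (compose_poly b F)"
      using \<open>x \<in> _\<close> by (rule pullback_field_memE)
    \<comment> \<open>Inversion swaps \<open>a\<close> and \<open>b\<close>, unless \<open>a\<close>
      pulls back to zero; then \<open>x = 0\<close>, and its inverse is \<open>0\<close> by
      convention.\<close>
    show ?thesis
    proof (cases "compose_poly a F = 0")
      case True
      thus ?thesis using x that by simp
    next
      case False
      thus ?thesis using I[OF x(2,1)] x(4) by simp
    qed
  qed
  ultimately show ?thesis using one by (auto simp: subfield_set_def subring_set_def)
qed

lemma const_in_pullback_field: "to_fract (const_poly c) \<in> pullback_field N F"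
  using pullback_field_memI[of "const_poly c" N 0 1 F] by (simp add: forms_eq)

text \<open>Dehomogenisation: a monomial of degree \<open>d\<close> has \<open>d\<close> factors
  \<open>F i\<close>, and \<open>w ^ d\<close> supplies one divisor \<open>w\<close> for each of
  them.\<close>

lemma compose_form_div_power_mem:
  assumes A: "subring_set A" and const: "\<And>c. to_fract (const_poly c) \<in> A"
    and F: "\<And>i. i \<le> N \<Longrightarrow> to_fract (F i) / w \<in> A" and p: "p \<in> forms N d"
  shows "to_fract (compose_poly p F) / w ^ d \<in> A"
  using p unfolding forms_eq
proof (induction rule: forms_in_induct)
  case zero
  show ?case using subring_setD(2)[OF A] by simp
next
  case (monom m a)
  have prod: "to_fract (prod g I) = (\<Prod>i\<in>I. to_fract (g i))" for g :: "nat \<Rightarrow> cpoly" and I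
    by (induction I rule: infinite_finite_induct) simp_all
  have pow: "to_fract (x ^ k) = to_fract x ^ k" for x :: cpoly and k
    by (induction k) simp_all
  have "w ^ d = (\<Prod>i\<in>Poly_Mapping.keys m. w ^ Poly_Mapping.lookup m i)"
    by (simp add: monom_deg_def power_sum flip: monom(2))
  hence "to_fract (compose_poly (const_poly a * monom_poly m) F) / w ^ d
      = to_fract (const_poly a) * (\<Prod>i\<in>Poly_Mapping.keys m. (to_fract (F i) / w) ^ Poly_Mapping.lookup m i)"
    by (simp add: compose_monom subst_monom_def prod pow prod_dividef power_divide)
  also have "\<dots> \<in> A" using monom(1)
    by (intro subring_setD(6)[OF A] const subring_set_prod[OF A] subring_set_power[OF A] F) auto
  finally show ?case .
next
  case (add p q)
  thus ?case using subring_setD(4)[OF A add.IH] by (simp add: add_divide_distrib)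
qed

text \<open>Numerator and denominator have the same degree and are divided by the same power of
  \<open>w\<close>. Below, \<open>A\<close> is the field \<open>K'\<close> or one of the rings
  \<open>K[t]\<close> and \<open>L[t]\<close>.\<close>

lemma pullback_field_fractions:
  assumes A: "subring_set A" and const: "\<And>c. to_fract (const_poly c) \<in> A"
    and F: "\<And>i. i \<le> N \<Longrightarrow> to_fract (F i) / w \<in> A" and w: "w \<noteq> 0"
    and x: "x \<in> pullback_field N F"
  shows "\<exists>p\<in>A. \<exists>q\<in>A. q \<noteq> 0 \<and> x = p / q"
proof -
  obtain a b d where *: "a \<in> forms N d" "b \<in> forms N d" "compose_poly b F \<noteq> 0"
    "x = to_fract (compose_poly a F) / to_fract (compose_poly b F)"
    using x by (rule pullback_field_memE)
  show ?thesis
  proof (intro bexI conjI)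
    show "x = (to_fract (compose_poly a F) / w ^ d) / (to_fract (compose_poly b F) / w ^ d)"
      using w * by simp
    show "to_fract (compose_poly b F) / w ^ d \<noteq> 0" using w * by simp
  qed (use compose_form_div_power_mem[OF A const F] * in auto)
qed

section \<open>Transcendence of a new variable over fractions in the others\<close>

definition fractions_in :: "nat set \<Rightarrow> cpoly fract set" where
  "fractions_in V = {to_fract a / to_fract b | a b. poly_vars a \<subseteq> V \<and> poly_vars b \<subseteq> V \<and> b \<noteq> 0}"

lemma fractions_in_mult:
  assumes "x \<in> fractions_in V" "y \<in> fractions_in V"
  shows "x * y \<in> fractions_in V"
proof -
  obtain a b c d where "x = to_fract a / to_fract b" "y = to_fract c / to_fract d"
    and v: "poly_vars a \<subseteq> V" "poly_vars b \<subseteq> V" "b \<noteq> 0" "poly_vars c \<subseteq> V" "poly_vars d \<subseteq> V" "d \<noteq> 0"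
    using assms unfolding fractions_in_def by blast
  hence "x * y = to_fract (a * c) / to_fract (b * d)" by simp
  moreover have "poly_vars (a * c) \<subseteq> V" "poly_vars (b * d) \<subseteq> V" "b * d \<noteq> 0"
    using v poly_vars_mult[of a c] poly_vars_mult[of b d] by auto
  ultimately show ?thesis unfolding fractions_in_def by blast
qed

lemma fractions_in_power: "x \<in> fractions_in V \<Longrightarrow> x ^ k \<in> fractions_in V"
proof (induction k)
  case 0
  show ?case by (auto simp: fractions_in_def intro!: exI[of _ 1])
qed (auto intro: fractions_in_mult)

lemma compose_restrict_vars:
  assumes "poly_vars p \<subseteq> V" "\<And>i. i \<in> V \<Longrightarrow> F i = coord_poly i"
  shows "compose_poly p F = p"
proof -
  have "compose_poly p F = compose_poly p coord_poly"
    using assms by (intro compose_poly_cong) auto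
  thus ?thesis by simp
qed

text \<open>Setting \<open>x\<^sub>j = 0\<close> isolates the constant coefficient.\<close>

lemma coord_poly_transcendental:
  assumes "j \<notin> V" "\<And>i. poly_vars (coeff p i) \<subseteq> V" "poly p (coord_poly j) = 0"
  shows "p = 0"
  using assms(2,3)
proof (induction p)
  case (pCons a p)
  define \<sigma> where "\<sigma> i = (if i = j then 0 else coord_poly i)" for i
  have a: "poly_vars a \<subseteq> V" and p: "poly_vars (coeff p i) \<subseteq> V" for i
    using pCons.prems(1)[of 0] pCons.prems(1)[of "Suc i"] by simp_all
  have "compose_poly (a + coord_poly j * poly p (coord_poly j)) \<sigma> = 0"
    using pCons.prems(2) by simp
  moreover have "compose_poly a \<sigma> = a"
    by (rule compose_restrict_vars[OF a]) (use assms(1) in \<open>auto simp: \<sigma>_def\<close>)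
  ultimately have "a = 0" by (simp add: \<sigma>_def)
  moreover from this have "poly p (coord_poly j) = 0" using pCons.prems(2) by simp
  ultimately show ?case using pCons.IH[OF p] by simp
qed simp

text \<open>Makes \<open>coord_poly_transcendental\<close> applicable to fractional coefficients.
  The common denominator is the product of the individual ones and stays in the variables
  \<open>V\<close>.\<close>

lemma clear_denominators:
  assumes "\<And>i. coeff p i \<in> fractions_in V"
  shows "\<exists>d q. d \<noteq> 0 \<and> poly_vars d \<subseteq> V \<and> (\<forall>i. poly_vars (coeff q i) \<subseteq> V) \<and> smult (to_fract d) p = map_poly to_fract q"
  using assms
proof (induction p)
  case 0
  show ?case by (intro exI[of _ 1] exI[of _ 0]) simp
next
  case (pCons x p)
  have "x \<in> fractions_in V" and p: "coeff p i \<in> fractions_in V" for i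
    using pCons.prems[of 0] pCons.prems[of "Suc i"] by simp_all
  then obtain a b where x: "x = to_fract a / to_fract b" "poly_vars a \<subseteq> V" "poly_vars b \<subseteq> V" "b \<noteq> 0"
    unfolding fractions_in_def by blast
  obtain d q where d: "d \<noteq> 0" "poly_vars d \<subseteq> V" "\<forall>i. poly_vars (coeff q i) \<subseteq> V"
    "smult (to_fract d) p = map_poly to_fract q"
    using pCons.IH[OF p] by blast
  have "smult (to_fract b) (smult (to_fract d) p) = map_poly to_fract (smult b q)"
    unfolding d(4) by simp
  hence "smult (to_fract (b * d)) (pCons x p) = map_poly to_fract (pCons (d * a) (smult b q))"
    using x(4) by (simp add: x(1) map_poly_pCons)
  moreover have "poly_vars (coeff (pCons (d * a) (smult b q)) i) \<subseteq> V" for i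
  proof (cases i)
    case 0
    show ?thesis using d(2) x(2) poly_vars_mult[of d a] by (auto simp: 0)
  next
    case (Suc k)
    have "poly_vars (b * coeff q k) \<subseteq> V" using poly_vars_mult[of b "coeff q k"] x(3) d(3) by blast
    thus ?thesis by (simp add: Suc)
  qed
  moreover have "poly_vars (b * d) \<subseteq> V" using d x poly_vars_mult[of b d] by auto
  ultimately show ?case using d(1) x(4)
    by (intro exI[of _ "b * d"] exI[of _ "pCons (d * a) (smult b q)"]) auto
qed

text \<open>The factor \<open>u\<close> is absorbed by substituting \<open>u X\<close> for
  \<open>X\<close>, which multiplies the \<open>i\<close>-th coefficient by the nonzero
  \<open>u ^ i\<close>. This leaves the case of the bare variable, settled by clearing
  denominators.\<close>

lemma coord_poly_transcendental_fractions:
  assumes j: "j \<notin> V" and u: "u \<in> fractions_in V" "u \<noteq> 0"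
    and p: "\<And>i. coeff p i \<in> fractions_in V" and zero: "poly p (u * to_fract (coord_poly j)) = 0"
  shows "p = 0"
proof -
  have P: "q = 0" if q: "\<And>i. coeff q i \<in> fractions_in V" "poly q (to_fract (coord_poly j)) = 0" for q
  proof -
    obtain d r where d: "d \<noteq> 0" "\<forall>i. poly_vars (coeff r i) \<subseteq> V" "smult (to_fract d) q = map_poly to_fract r"
      using clear_denominators[OF q(1)] by blast
    have "poly (map_poly to_fract r) (to_fract x) = to_fract (poly r x)" for r and x :: cpoly
      by (induction r) (simp_all add: map_poly_pCons)
    hence "to_fract (poly r (coord_poly j)) = poly (smult (to_fract d) q) (to_fract (coord_poly j))"
      by (simp only: d(3))
    also have "\<dots> = 0" using q(2) by simp
    finally have "r = 0" using coord_poly_transcendental[OF j] d(2) by simp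
    thus "q = 0" using d by simp
  qed
  have "pcompose p [:0, u:] = 0"
  proof (rule P)
    show "coeff (pcompose p [:0, u:]) i \<in> fractions_in V" for i
      using u p by (auto simp: coeff_pcompose_linear intro!: fractions_in_mult fractions_in_power)
    show "poly (pcompose p [:0, u:]) (to_fract (coord_poly j)) = 0"
      using zero by (simp add: poly_pcompose mult.commute)
  qed
  hence "u ^ i * coeff p i = 0" for i by (metis coeff_pcompose_linear coeff_0)
  thus ?thesis using u(2) by (simp add: poly_eq_iff)
qed

section \<open>Adding a monomial in a new variable\<close>

text \<open>\<open>F\<close> and \<open>G\<close> stand for the toric polar maps of \<open>f\<close>
  and its extension, with \<open>e = k - 1\<close> and \<open>\<mu>\<close> the exponents of the
  monomial. Only this shape of the components is used; \<open>m\<close> is any nonzero form of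
  degree \<open>e\<close>.\<close>

locale polar_extension =
  fixes n e :: nat and F G :: "nat \<Rightarrow> cpoly" and m :: cpoly and \<mu> :: "nat \<Rightarrow> complex"
  assumes F: "i \<le> n \<Longrightarrow> F i \<in> forms n (Suc e)"
    and m: "m \<in> forms n e" "m \<noteq> 0"
    and G: "i \<le> n \<Longrightarrow> G i = F i + const_poly (\<mu> i) * (m * coord_poly (Suc n))"
    and G_Suc: "G (Suc n) = m * coord_poly (Suc n)"
begin

lemma forms_mono: "forms n d \<subseteq> forms (Suc n) d"
  unfolding forms_eq by (rule forms_in_mono) auto

lemma G_forms:
  assumes "i \<le> Suc n"
  shows "G i \<in> forms (Suc n) (Suc e)"
proof -
  have M: "m * coord_poly (Suc n) \<in> forms (Suc n) (Suc e)"
    using m forms_mono[of e] forms_in_mult[of m "{..Suc n}" e "coord_poly (Suc n)" "Suc 0"]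
    by (auto simp: forms_eq)
  have "const_poly (\<mu> i) * (m * coord_poly (Suc n)) \<in> forms (Suc n) (Suc e)"
    using M forms_in_mult[of "const_poly (\<mu> i)" "{..Suc n}" 0] by (simp add: forms_eq)
  hence "G i \<in> forms (Suc n) (Suc e)" if "i \<le> n"
    using F[OF that] forms_mono[of "Suc e"] G[OF that] by (auto simp: forms_eq intro: forms_in_add)
  thus ?thesis using assms M G_Suc by (cases "i \<le> n") (auto simp: le_Suc_eq)
qed

text \<open>Coordinates of the linear automorphisms that pass between \<open>G\<close> and the map
  with components \<open>F i\<close> and \<open>m x_{n+1}\<close>.\<close>

lemma forms_shear:
  "coord_poly i + const_poly c * coord_poly (Suc n) \<in> forms (Suc n) 1" if "i \<le> Suc n"
  using that forms_in_mult[of "const_poly c" "{..Suc n}" 0 "coord_poly (Suc n)" 1]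
  by (auto simp: forms_eq intro!: forms_in_add)

text \<open>Since \<open>F i = G i - \<mu> i G (n+1)\<close>, a relation among the
  \<open>F i\<close> becomes one among the \<open>G i\<close> by a linear substitution. Setting
  \<open>x_{n+1} = 0\<close> undoes that substitution, so no relation is lost.\<close>

lemma indep_forms_F:
  assumes "indep_forms (Suc n) G"
  shows "indep_forms n F"
  unfolding indep_forms_def
proof (intro allI ballI impI)
  fix d p assume p: "p \<in> forms n d" "compose_poly p F = 0"
  have vars: "poly_vars p \<subseteq> {..n}" using p(1) forms_in_vars by (simp add: forms_eq)
  define l where "l i = coord_poly i + const_poly (- \<mu> i) * coord_poly (Suc n)" for i
  have "compose_poly p l \<in> forms_in {..Suc n} (d * 1)"
    using p(1) forms_shear unfolding l_def
    by (intro forms_in_compose[of _ "{..n}"]) (auto simp: forms_eq)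
  moreover have "compose_poly (compose_poly p l) G = compose_poly p F"
    unfolding compose_poly_assoc
  proof (rule compose_poly_cong)
    fix i assume "i \<in> poly_vars p"
    hence "i \<le> n" using vars by auto
    moreover have "const_poly (- \<mu> i) = - const_poly (\<mu> i)"
      by (simp add: const_poly_def single_uminus)
    ultimately show "compose_poly (l i) G = F i" by (simp add: l_def G G_Suc)
  qed
  ultimately have "compose_poly p l = 0"
    using assms p(2) unfolding indep_forms_def by (auto simp: forms_eq)
  moreover have "compose_poly (compose_poly p l) (\<lambda>i. if i \<le> n then coord_poly i else 0) = p"
    unfolding compose_poly_assoc
    by (rule compose_restrict_vars[OF vars]) (simp add: l_def)
  ultimately show "p = 0" by simp
qed

text \<open>Induction on the degree with \<open>p = r + x_{n+1} q\<close>. After composition with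
  \<open>H\<close>, setting \<open>x_{n+1} = 0\<close> leaves only \<open>r\<close> composed with
  \<open>F\<close>, so \<open>r = 0\<close> by independence; cancelling \<open>m x_{n+1}\<close>
  then leaves a relation \<open>q\<close> of smaller degree.\<close>

lemma compose_F_times_coord_eq_0:
  assumes ind: "indep_forms n F" and H: "\<And>i. i \<le> n \<Longrightarrow> H i = F i" "H (Suc n) = m * coord_poly (Suc n)"
    and p: "p \<in> forms_in {..Suc n} d" "compose_poly p H = 0"
  shows "p = 0"
  using p
proof (induction d arbitrary: p rule: less_induct)
  case (less d)
  have "p \<in> forms_in (insert (Suc n) {..n}) d" using less.prems(1) by (simp add: atMost_Suc)
  then obtain r q where rq: "p = r + coord_poly (Suc n) * q" "r \<in> forms_in {..n} d"
    "q \<in> forms_in (insert (Suc n) {..n}) (d - 1)" "d = 0 \<longrightarrow> q = 0"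
    by (rule forms_in_insert_decompose)
  have rH: "compose_poly r H = compose_poly r F"
    using forms_in_vars[OF rq(2)] H(1) by (intro compose_poly_cong) auto
  have rF: "compose_poly r F \<in> forms_in {..n} (d * Suc e)"
    using rq(2) F by (intro forms_in_compose) (auto simp: forms_eq)
  have eq: "compose_poly r F + m * coord_poly (Suc n) * compose_poly q H = 0"
    using less.prems(2) rq(1) H(2) rH by simp
  define \<sigma> where "\<sigma> i = (if i \<le> n then coord_poly i else 0)" for i
  have "compose_poly (compose_poly r F) \<sigma> = compose_poly r F"
    by (rule compose_restrict_vars[OF forms_in_vars[OF rF]]) (simp add: \<sigma>_def)
  moreover have "compose_poly (compose_poly r F + m * coord_poly (Suc n) * compose_poly q H) \<sigma> = 0"
    unfolding eq by simp
  ultimately have "compose_poly r F = 0" by (simp add: \<sigma>_def)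
  moreover from this have "r = 0"
    using ind rq(2) unfolding indep_forms_def by (auto simp: forms_eq)
  ultimately have "compose_poly q H = 0" using eq m(2) by simp
  hence "q = 0" using less.IH[of "d - 1" q] rq(3,4) by (cases "d = 0") (auto simp: atMost_Suc)
  thus ?case using rq(1) \<open>r = 0\<close> by simp
qed

lemma indep_forms_G:
  assumes "indep_forms n F"
  shows "indep_forms (Suc n) G"
  unfolding indep_forms_def
proof (intro allI ballI impI)
  fix d p assume p: "p \<in> forms (Suc n) d" "compose_poly p G = 0"
  have vars: "poly_vars p \<subseteq> {..Suc n}" using p(1) forms_in_vars by (simp add: forms_eq)
  \<comment> \<open>Extending \<open>\<mu>\<close> by \<open>0\<close> makes the shear
    \<open>l\<close> fix \<open>x_{n+1}\<close>, so that \<open>l'\<close> is its inverse.\<close>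
  define \<nu> where "\<nu> i = (if i \<le> n then \<mu> i else 0)" for i
  define l where "l i = coord_poly i + const_poly (\<nu> i) * coord_poly (Suc n)" for i
  define l' where "l' i = coord_poly i + const_poly (- \<nu> i) * coord_poly (Suc n)" for i
  define H where "H i = (if i \<le> n then F i else m * coord_poly (Suc n))" for i
  have 0: "const_poly 0 = 0" by (rule const_hom.c_0)
  have pl: "compose_poly p l \<in> forms_in {..Suc n} (d * 1)"
    using p(1) forms_shear unfolding l_def
    by (intro forms_in_compose[of _ "{..Suc n}"]) (auto simp: forms_eq)
  have "compose_poly (compose_poly p l) H = compose_poly p G"
    unfolding compose_poly_assoc
  proof (rule compose_poly_cong)
    fix i assume "i \<in> poly_vars p"
    hence "i \<le> n \<or> i = Suc n" using vars by auto
    thus "compose_poly (l i) H = G i" by (auto simp: l_def \<nu>_def H_def G G_Suc 0)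
  qed
  hence "compose_poly p l = 0"
    using compose_F_times_coord_eq_0[OF assms _ _ pl, of H] p(2) by (simp add: H_def)
  moreover have "compose_poly (compose_poly p l) l' = p"
    unfolding compose_poly_assoc
  proof (rule compose_restrict_vars[OF vars])
    fix i
    have "const_poly (- \<nu> i) = - const_poly (\<nu> i)"
      by (simp add: const_poly_def single_uminus)
    thus "compose_poly (l i) l' = coord_poly i"
      by (simp add: l_def l'_def \<nu>_def 0)
  qed
  ultimately show "p = 0" by simp
qed

lemma dominant_iff: "dominant (Suc n) G \<longleftrightarrow> dominant n F"
  using dominant_iff_indep_forms[of "Suc n" G "Suc e"] dominant_iff_indep_forms[of n F "Suc e"]
    G_forms F indep_forms_F indep_forms_G by blast

text \<open>Dividing by \<open>F 0\<close> turns \<open>G i\<close> into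
  \<open>F i / F 0 + \<mu> i t\<close> and the last component into \<open>t\<close>, so the target
  side is \<open>K(t)\<close>. On the source side \<open>x_{n+1} / x_0\<close> is an element of
  \<open>L\<close> times \<open>t\<close>, so that side is \<open>L(t)\<close>.\<close>

lemma transcendental_extension_pullback:
  assumes F0: "F 0 \<noteq> 0"
  shows "transcendental_extension (pullback_field n F) (function_field n) (pullback_field (Suc n) G)
    (function_field (Suc n)) (to_fract (m * coord_poly (Suc n)) / to_fract (F 0))"
proof -
  define M where "M = m * coord_poly (Suc n)"
  define t where "t = to_fract M / to_fract (F 0)"
  define K L K' L' where "K = pullback_field n F" and "L = function_field n"
    and "K' = pullback_field (Suc n) G" and "L' = function_field (Suc n)"
  note defs = K_def L_def K'_def L'_def
  have sf: "subfield_set K" "subfield_set L" "subfield_set K'" "subfield_set L'"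
    unfolding defs function_field_eq by (rule subfield_pullback_field)+
  note sr = subfield_setD(1)[OF sf(1)] subfield_setD(1)[OF sf(2)] subfield_setD(1)[OF sf(3)]
  have const: "to_fract (const_poly c) \<in> K" "to_fract (const_poly c) \<in> L" "to_fract (const_poly c) \<in> K'" for c
    unfolding defs function_field_eq by (rule const_in_pullback_field)+
  have KL: "pullback_field N H \<subseteq> function_field N" if "\<And>i. i \<le> N \<Longrightarrow> H i \<in> forms N d" for N H d
  proof
    fix x assume "x \<in> pullback_field N H"
    then obtain a b c where x: "a \<in> forms N c" "b \<in> forms N c" "compose_poly b H \<noteq> 0"
      "x = to_fract (compose_poly a H) / to_fract (compose_poly b H)"
      by (rule pullback_field_memE)
    have "compose_poly a H \<in> forms N (c * d)" "compose_poly b H \<in> forms N (c * d)"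
      using x that unfolding forms_eq by (auto intro!: forms_in_compose)
    thus "x \<in> function_field N"
      using pullback_field_memI[of _ N _ _ coord_poly] x unfolding function_field_eq by simp
  qed
  have F_K: "to_fract (F i) / to_fract (F 0) \<in> K" if "i \<le> n" for i
    using pullback_field_memI[of "coord_poly i" n 1 "coord_poly 0" F] that F0
    by (simp add: K_def forms_eq)
  have fin: "to_fract a / to_fract b \<in> L" if "a \<in> forms n d" "b \<in> forms n d" "b \<noteq> 0" for a b d
    using pullback_field_memI[of a n d b coord_poly] that by (simp add: L_def function_field_eq)
  \<comment> \<open>\<open>l i\<close> pulls back along \<open>G\<close> to \<open>F i\<close>;
    hence \<open>l 0\<close> is a legitimate denominator for \<open>t\<close> and for the quotients
    \<open>F i / F 0\<close> in \<open>K'\<close>.\<close>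
  define l where "l i = coord_poly i + const_poly (- \<mu> i) * coord_poly (Suc n)" for i
  have l: "l i \<in> forms (Suc n) 1" "compose_poly (l i) G = F i" if "i \<le> n" for i
  proof -
    have "const_poly (- \<mu> i) = - const_poly (\<mu> i)"
      by (simp add: const_poly_def single_uminus)
    thus "compose_poly (l i) G = F i" using that by (simp add: l_def G G_Suc)
    show "l i \<in> forms (Suc n) 1" unfolding l_def by (rule forms_shear) (use that in simp)
  qed
  have t_K': "t \<in> K'"
    using pullback_field_memI[of "coord_poly (Suc n)" "Suc n" 1 "l 0" G] l[of 0] F0
    by (simp add: K'_def t_def M_def forms_eq G_Suc)
  have F_K': "to_fract (F i) / to_fract (F 0) \<in> K'" if "i \<le> n" for i
    using pullback_field_memI[of "l i" "Suc n" 1 "l 0" G] l[OF that] l[of 0] F0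
    by (simp add: K'_def)
  have C: "[:c:] \<in> polys_over A" "[:c, d:] \<in> polys_over A" if "subring_set A" "c \<in> A" "d \<in> A"
    for c d and A :: "cpoly fract set"
    using that subring_setD(2)[OF that(1)] by (auto simp: polys_over_def coeff_pCons split: nat.splits)
  \<comment> \<open>Both fraction conditions reduce to showing that the components divided by a
    suitable \<open>w\<close> lie in \<open>A[t]\<close>.\<close>
  have vals: "\<exists>p\<in>polys_over A. \<exists>q\<in>polys_over A. poly q t \<noteq> 0 \<and> x = poly p t / poly q t"
    if A: "subring_set A" "\<And>c. to_fract (const_poly c) \<in> A" and w: "w \<noteq> 0"
      and H: "\<And>i. i \<le> Suc n \<Longrightarrow> to_fract (H i) / w \<in> (\<lambda>p. poly p t) ` polys_over A"
      and x: "x \<in> pullback_field (Suc n) H" for A H w x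
  proof -
    have "to_fract (const_poly c) \<in> (\<lambda>p. poly p t) ` polys_over A" for c
      using C(1)[OF A(1) A(2) A(2)] by (intro image_eqI[of _ _ "[:to_fract (const_poly c):]"]) auto
    from pullback_field_fractions[OF subring_poly_values[OF A(1)] this H w x]
    show ?thesis by blast
  qed
  have "transcendental_extension K L K' L' t"
  proof
    show "K \<subseteq> L" unfolding K_def L_def using F by (rule KL)
    show "K' \<subseteq> L'" unfolding K'_def L'_def using G_forms by (rule KL)
    show "L \<subseteq> L'"
      using forms_mono unfolding L_def L'_def function_field_def by blast
    show "K \<subseteq> K'"
    proof
      fix x assume "x \<in> K"
      hence "\<exists>p\<in>K'. \<exists>q\<in>K'. q \<noteq> 0 \<and> x = p / q"
        using pullback_field_fractions[OF sr(3) const(3) F_K', where x = x] F0 by (simp add: K_def)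
      thus "x \<in> K'" using subfield_setD(3)[OF sf(3)] by auto
    qed
    show "\<exists>p\<in>polys_over K. \<exists>q\<in>polys_over K. poly q t \<noteq> 0 \<and> x = poly p t / poly q t" if "x \<in> K'" for x
    proof (rule vals[where w = "to_fract (F 0)" and H = G])
      fix i assume "i \<le> Suc n"
      show "to_fract (G i) / to_fract (F 0) \<in> (\<lambda>p. poly p t) ` polys_over K"
      proof (cases "i \<le> n")
        case True
        thus ?thesis
          using C(2)[OF sr(1) F_K const(1), of i "\<mu> i"]
          by (intro image_eqI[of _ _ "[:to_fract (F i) / to_fract (F 0), to_fract (const_poly (\<mu> i)):]"])
            (auto simp: G t_def M_def add_divide_distrib)
      next
        case False
        hence "i = Suc n" using \<open>i \<le> Suc n\<close> by simp
        thus ?thesis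
          using C(2)[OF sr(1) subring_setD(2,1)[OF sr(1)]]
          by (intro image_eqI[of _ _ "[:0, 1:]"]) (auto simp: G_Suc t_def M_def)
      qed
    qed (use that sr const F0 in \<open>auto simp: K'_def\<close>)
    show "\<exists>p\<in>polys_over L. \<exists>q\<in>polys_over L. poly q t \<noteq> 0 \<and> x = poly p t / poly q t" if "x \<in> L'" for x
    proof (rule vals[where w = "to_fract (coord_poly 0)" and H = coord_poly])
      fix i assume i: "i \<le> Suc n"
      have c0: "coord_poly 0 \<in> forms n 1" by (simp add: forms_eq)
      show "to_fract (coord_poly i) / to_fract (coord_poly 0) \<in> (\<lambda>p. poly p t) ` polys_over L"
      proof (cases "i \<le> n")
        case True
        hence "to_fract (coord_poly i) / to_fract (coord_poly 0) \<in> L"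
          using c0 by (intro fin[of _ 1]) (auto simp: forms_eq)
        thus ?thesis
          using C(1)[OF sr(2)] by (intro image_eqI[of _ _ "[:_:]"]) auto
      next
        case False
        hence i: "i = Suc n" using \<open>i \<le> Suc n\<close> by simp
        \<comment> \<open>Chosen so that \<open>c * t\<close> is \<open>x_{n+1} / x_0\<close>;
          numerator and denominator both have degree \<open>e + 1\<close>.\<close>
        define c where "c = to_fract (F 0) / to_fract (m * coord_poly 0)"
        have "m * coord_poly 0 \<in> forms n (Suc e)"
          using forms_in_mult[of m "{..n}" e "coord_poly 0" 1] m(1) c0 by (simp add: forms_eq)
        hence "c \<in> L" unfolding c_def using F m(2) by (intro fin[of _ "Suc e"]) auto
        thus ?thesis
          using C(2)[OF sr(2) subring_setD(2)[OF sr(2)], of c] F0 m(2)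
          by (intro image_eqI[of _ _ "[:0, c:]"]) (auto simp: i c_def t_def M_def)
      qed
    qed (use that sr const in \<open>auto simp: L'_def function_field_eq\<close>)
    show "p = 0" if p: "p \<in> polys_over L" "poly p t = 0" for p
    proof (rule coord_poly_transcendental_fractions[where V = "{..n}" and j = "Suc n"])
      have vars: "poly_vars a \<subseteq> {..n}" if "a \<in> forms n d" for a d
        using that forms_in_vars by (simp add: forms_eq)
      \<comment> \<open>This quotient has degree \<open>-1\<close> and so is not in
        \<open>L\<close>; this is why transcendence is proved over all fractions in
        \<open>x_0, ..., x_n\<close>.\<close>
      show "to_fract m / to_fract (F 0) \<in> fractions_in {..n}"
        using vars[OF m(1)] vars[OF F[of 0]] F0 by (auto simp: fractions_in_def)
      show "poly p (to_fract m / to_fract (F 0) * to_fract (coord_poly (Suc n))) = 0"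
        using p(2) by (simp add: t_def M_def)
      have "L \<subseteq> fractions_in {..n}"
        using vars unfolding L_def function_field_def fractions_in_def Fract_conv_to_fract by blast
      thus "coeff p i \<in> fractions_in {..n}" for i using p(1) by (auto simp: polys_over_def)
    qed (use m(2) F0 in auto)
  qed (use sf t_K' in auto)
  thus ?thesis by (simp add: defs t_def M_def)
qed

lemma rat_map_degree_eq: "rat_map_degree (Suc n) G = rat_map_degree n F"
proof (cases "dominant n F")
  case True
  hence "indep_forms n F" using dominant_iff_indep_forms[of n F] F by blast
  \<comment> \<open>If \<open>F 0\<close> were zero, the form \<open>x_0\<close> would be a
    relation.\<close>
  hence "F 0 \<noteq> 0"
    unfolding indep_forms_def using compose_poly_simps(4)[of 0 F] coord_poly_neq_0[of 0]
      forms_in_simps(4)[of 0 "{..n}"] by (metis forms_eq atMost_iff le0)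
  then interpret transcendental_extension "pullback_field n F" "function_field n"
    "pullback_field (Suc n) G" "function_field (Suc n)"
    "to_fract (m * coord_poly (Suc n)) / to_fract (F 0)"
    by (rule transcendental_extension_pullback)
  have "ring (ring_of_type_algebra :: cpoly fract ring)" by (rule ring_from_type_algebra)
  thus ?thesis
    using True dominant_iff by (simp add: rat_map_degree_def ring.dim_def dimension_iff)
qed (use dominant_iff in \<open>simp add: rat_map_degree_def\<close>)

end

section \<open>Toric polar maps\<close>

text \<open>The operator \<open>x_i\<close> times the derivative in \<open>x_i\<close> restores each
  monomial and multiplies it by its exponent at \<open>i\<close>. Where that exponent is
  \<open>0\<close> the truncated subtraction is harmless, as the coefficient vanishes.\<close>

lemma lookup_toric_polar_map:
  "Poly_Mapping.lookup (toric_polar_map g i) a = of_nat (Poly_Mapping.lookup a i) * Poly_Mapping.lookup g a"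
proof -
  have *: "coord_poly i * Poly_Mapping.single (m - Poly_Mapping.single i 1) (of_nat (Poly_Mapping.lookup m i) * c)
      = Poly_Mapping.single m (of_nat (Poly_Mapping.lookup m i) * c)" for m c
  proof (cases "Poly_Mapping.lookup m i = 0")
    case False
    hence "Poly_Mapping.single i 1 + (m - Poly_Mapping.single i 1) = m"
      by (intro poly_mapping_eqI) (auto simp: lookup_add lookup_minus lookup_single when_def)
    thus ?thesis by (simp add: coord_poly_def mult_single)
  qed simp
  have "toric_polar_map g i = (\<Sum>m\<in>Poly_Mapping.keys g.
      Poly_Mapping.single m (of_nat (Poly_Mapping.lookup m i) * Poly_Mapping.lookup g m))"
    unfolding toric_polar_map_def partial_deriv_def sum_distrib_left * ..
  thus ?thesis by (auto simp: lookup_sum lookup_single when_def in_keys_iff)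
qed

lemma toric_polar_map_add: "toric_polar_map (f + g) i = toric_polar_map f i + toric_polar_map g i"
  by (rule poly_mapping_eqI) (simp add: lookup_toric_polar_map lookup_add algebra_simps)

lemma toric_polar_map_single:
  "toric_polar_map (Poly_Mapping.single a 1) i = const_poly (of_nat (Poly_Mapping.lookup a i)) * Poly_Mapping.single a 1"
  unfolding const_poly_def mult_single
  by (rule poly_mapping_eqI) (simp add: lookup_toric_polar_map lookup_single when_def)

lemma toric_polar_map_forms:
  assumes "f \<in> forms n k"
  shows "toric_polar_map f i \<in> forms n k"
proof -
  have "Poly_Mapping.keys (toric_polar_map f i) \<subseteq> Poly_Mapping.keys f"
    by (auto simp: in_keys_iff lookup_toric_polar_map)
  thus ?thesis using assms by (auto simp: forms_def poly_vars_def)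
qed

lemma toric_polar_map_not_var:
  assumes "i \<notin> poly_vars f"
  shows "toric_polar_map f i = 0"
  using assms by (intro poly_mapping_eqI) (auto simp: lookup_toric_polar_map poly_vars_def in_keys_iff)

theorem proposition4p8:
  fixes n k :: nat and f :: cpoly and m :: cmonom
  assumes "k \<ge> 1"
    and "f \<in> forms n k"
    and "Poly_Mapping.keys m \<subseteq> {..n}"
    and "monom_deg m = k - 1"
  shows "rat_map_degree (n + 1) (toric_polar_map (f + monom_poly m * coord_poly (n + 1)))
       = rat_map_degree n (toric_polar_map f)"
proof -
  \<comment> \<open>As \<open>k \<ge> 1\<close>, the subtraction is not truncated and the components
    of the map have degree \<open>Suc (k - 1)\<close>.\<close>
  have k: "k = Suc (k - 1)" using assms(1) by simp
  define a where "a = m + Poly_Mapping.single (Suc n) 1"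
  have a: "monom_poly m * coord_poly (Suc n) = Poly_Mapping.single a 1"
    by (simp add: a_def monom_poly_def coord_poly_def mult_single)
  have [simp]: "Poly_Mapping.lookup m (Suc n) = 0" using assms(3) by (auto simp: in_keys_iff)
  \<comment> \<open>The form \<open>f\<close> does not contain \<open>x_{n+1}\<close>, so the last
    component of the extended map comes from the added monomial alone.\<close>
  have f: "toric_polar_map f (Suc n) = 0"
    using assms(2) by (intro toric_polar_map_not_var) (auto simp: forms_def)
  interpret polar_extension n "k - 1" "toric_polar_map f"
    "toric_polar_map (f + monom_poly m * coord_poly (Suc n))" "monom_poly m"
    "\<lambda>i. of_nat (Poly_Mapping.lookup m i)"
  proof
    show "toric_polar_map f i \<in> forms n (Suc (k - 1))" for i
      using toric_polar_map_forms assms(2) k by simp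
    show "monom_poly m \<in> forms n (k - 1)"
      using assms(3,4) by (simp add: forms_eq forms_in_monom)
    show "monom_poly m \<noteq> 0" by (simp add: monom_poly_def flip: keys_eq_empty)
    show "toric_polar_map (f + monom_poly m * coord_poly (Suc n)) i = toric_polar_map f i
        + const_poly (of_nat (Poly_Mapping.lookup m i)) * (monom_poly m * coord_poly (Suc n))"
      if "i \<le> n" for i
      using that by (simp add: a toric_polar_map_add toric_polar_map_single)
        (simp add: a_def lookup_add lookup_single)
    show "toric_polar_map (f + monom_poly m * coord_poly (Suc n)) (Suc n) = monom_poly m * coord_poly (Suc n)"
      by (simp add: a toric_polar_map_add toric_polar_map_single f)
        (simp add: a_def lookup_add lookup_single const_hom.c_1)
  qed
  show ?thesis using rat_map_degree_eq by simp
qed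

end
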